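(* Let $1<m<\infty$. There is a constant $C>0$ (depending only on $m$) such that for every radial $(v_0,v_1)\in\mathcal{L}^m$, the solution $v$ of the linear wave equation $\partial_t^2v-\Delta v=0$ on $\mathbb{R}\times\mathbb{R}^3$ with $(v,\partial_tv)|_{t=0}=(v_0,v_1)$ satisfies $v\in S(\mathbb{R})$ and $$\|v\|_{S(\mathbb{R})}\leq C\|(v_0,v_1)\|_{\mathcal{L}^m}.$$
   Context: All functions are radial in $x\in\mathbb{R}^3$, $r=|x|$. The space $\mathcal{L}^m$ is the closure of the pairs of radial, smooth, compactly supported functions on $\mathbb{R}^3$ for the norm $$\|(u_0,u_1)\|_{\mathcal{L}^m}=\Big(\int_0^{+\infty}\big(|r\partial_ru_0|^m+|ru_1|^m\big)\,dr\Big)^{1/m}.$$ For a real interval $I$, $$\|f\|_{S(I)}=\Big(\int_I\Big(\int_0^{+\infty}|f(t,r)|^{(2m+1)m}\,r^m\,dr\Big)^{1/m}dt\Big)^{\frac{1}{2m+1}},$$ and $S(I)$ is the space defined by this norm. The solution of the linear wave equation with radial data $(v_0,v_1)\in\mathcal{L}^m$ is given by $v(t,r)=\frac1r\big(F(t+r)-F(t-r)\big)$, where $F(\sigma)=\frac12\sigma v_0(|\sigma|)+\frac12\int_0^{|\sigma|}\rho\,v_1(\rho)\,d\rho$. *)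

theory Defs
  imports "HOL-Analysis.Analysis"
begin

text \<open>
  A radial function \<open>x \<mapsto> u \<bar>x\<bar>\<close> is represented by its profile \<open>u :: real \<Rightarrow> real\<close>, of which only
  the values at \<open>r > 0\<close> (\<open>r \<ge> 0\<close> for test functions) are relevant.
\<close>

subsection \<open>Radial test functions\<close>

primrec Ck :: "nat \<Rightarrow> ('a::real_normed_vector \<Rightarrow> real) \<Rightarrow> bool" where
  "Ck 0 f \<longleftrightarrow> continuous_on UNIV f"
| "Ck (Suc k) f \<longleftrightarrow>
     (\<forall>x. f differentiable (at x)) \<and> (\<forall>h. Ck k (\<lambda>x. frechet_derivative f (at x) h))"

definition smooth :: "('a::real_normed_vector \<Rightarrow> real) \<Rightarrow> bool" where
  "smooth f \<longleftrightarrow> (\<forall>k. Ck k f)"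

definition radial_test :: "(real \<Rightarrow> real) \<Rightarrow> bool" where
  "radial_test u \<longleftrightarrow>
     smooth (\<lambda>x::real^3. u (norm x)) \<and> compact (closure {x::real^3. u (norm x) \<noteq> 0})"

subsection \<open>The space \<open>\<L>\<^sup>m\<close>\<close>

text \<open>Powers of extended nonnegative reals, for exponents \<open>p > 0\<close>.\<close>

definition epowr :: "ennreal \<Rightarrow> real \<Rightarrow> ennreal" where
  "epowr x p = (if x = \<infinity> then \<infinity> else ennreal (enn2real x powr p))"

definition Lm_norm :: "real \<Rightarrow> (real \<Rightarrow> real) \<Rightarrow> (real \<Rightarrow> real) \<Rightarrow> ennreal" where
  "Lm_norm m u0 u1 =
     epowr (\<integral>\<^sup>+ r \<in> {0<..}. ennreal (\<bar>r * deriv u0 r\<bar> powr m + \<bar>r * u1 r\<bar> powr m) \<partial>lebesgue) (1 / m)"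

text \<open>
  Local absolute continuity on \<open>(0,\<infinity>)\<close>: the a.e. derivative is locally integrable and
  \<open>u\<close> is its primitive, so that \<open>deriv u\<close> is the weak derivative of \<open>u\<close>.
\<close>

definition loc_abs_cont :: "(real \<Rightarrow> real) \<Rightarrow> bool" where
  "loc_abs_cont u \<longleftrightarrow>
     (\<forall>a b. 0 < a \<and> a \<le> b \<longrightarrow>
        deriv u absolutely_integrable_on {a..b} \<and> u b - u a = integral {a..b} (deriv u))"

text \<open>
  The ambient space in which the closure of the test pairs is taken. The norm does not see
  additive constants in \<open>u0\<close>; they are excluded by decay at infinity, a property that, for
  \<open>m > 1\<close>, passes from test functions to their limits because
  \<open>\<bar>u r\<bar> \<le> const * r powr (-1/m) * Lm_norm m u 0\<close>.
  On this space (modulo equality a.e. of \<open>u1\<close>) the norm is a complete norm.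
\<close>

definition Lm_ambient :: "real \<Rightarrow> ((real \<Rightarrow> real) \<times> (real \<Rightarrow> real)) set" where
  "Lm_ambient m =
     {(u0, u1). loc_abs_cont u0 \<and> (u0 \<longlongrightarrow> 0) at_top \<and>
                u1 \<in> borel_measurable (lebesgue_on {0<..}) \<and> Lm_norm m u0 u1 < \<infinity>}"

definition Lm :: "real \<Rightarrow> ((real \<Rightarrow> real) \<times> (real \<Rightarrow> real)) set" where
  "Lm m =
     {(u0, u1) \<in> Lm_ambient m.
        \<forall>\<epsilon>>0. \<exists>\<phi> \<psi>. radial_test \<phi> \<and> radial_test \<psi> \<and>
          Lm_norm m (\<lambda>r. u0 r - \<phi> r) (\<lambda>r. u1 r - \<psi> r) < ennreal \<epsilon>}"

subsection \<open>The space \<open>S(I)\<close>\<close>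

definition S_norm :: "real \<Rightarrow> real set \<Rightarrow> (real \<Rightarrow> real \<Rightarrow> real) \<Rightarrow> ennreal" where
  "S_norm m I f =
     epowr (\<integral>\<^sup>+ t \<in> I.
              epowr (\<integral>\<^sup>+ r \<in> {0<..}. ennreal (\<bar>f t r\<bar> powr ((2 * m + 1) * m) * r powr m) \<partial>lebesgue)
                (1 / m)
            \<partial>lebesgue)
       (1 / (2 * m + 1))"

definition S_space :: "real \<Rightarrow> real set \<Rightarrow> (real \<Rightarrow> real \<Rightarrow> real) set" where
  "S_space m I =
     {f. (\<lambda>(t, r). f t r) \<in> borel_measurable (lebesgue_on (I \<times> {0<..})) \<and> S_norm m I f < \<infinity>}"

subsection \<open>The radial linear wave equation\<close>

definition wave_F :: "(real \<Rightarrow> real) \<Rightarrow> (real \<Rightarrow> real) \<Rightarrow> real \<Rightarrow> real" where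
  "wave_F v0 v1 \<sigma> =
     1/2 * \<sigma> * v0 \<bar>\<sigma>\<bar> + 1/2 * (LINT \<rho>:{0..\<bar>\<sigma>\<bar>}|lebesgue. \<rho> * v1 \<rho>)"

text \<open>
  The solution with data \<open>(v0, v1)\<close> at time \<open>0\<close>, for data in \<open>\<L>\<^sup>m\<close> given by d'Alembert's formula
  for \<open>r * v\<close>. For test data it is the classical solution: see \<open>linear_wave_classical\<close> below.
\<close>

definition linear_wave :: "(real \<Rightarrow> real) \<Rightarrow> (real \<Rightarrow> real) \<Rightarrow> real \<Rightarrow> real \<Rightarrow> real" where
  "linear_wave v0 v1 t r = (wave_F v0 v1 (t + r) - wave_F v0 v1 (t - r)) / r"

lemma linear_wave_initial:
  assumes "r > 0"
  shows "linear_wave v0 v1 0 r = v0 r"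
  using assms by (simp add: linear_wave_def wave_F_def field_simps)

lemma radial_test_even_extension:
  assumes "radial_test u"
  obtains g' g'' where
    "\<And>s. ((\<lambda>s. u \<bar>s\<bar>) has_real_derivative g' s) (at s)"
    "\<And>s. (g' has_real_derivative g'' s) (at s)"
proof -
  define f where "f = (\<lambda>x::real^3. u (norm x))"
  define e where "e = (axis 1 1 :: real^3)"
  have ne: "norm e = 1" by (simp add: e_def norm_eq_1 inner_axis_axis)
  have "Ck (Suc (Suc 0)) f" using assms by (simp add: radial_test_def smooth_def f_def)
  hence d1: "\<And>x. f differentiable (at x)"
    and d2: "\<And>x. (\<lambda>x. frechet_derivative f (at x) e) differentiable (at x)" by simp_all
  have line: "((\<lambda>s. h (s *\<^sub>R e)) has_real_derivative frechet_derivative h (at (s *\<^sub>R e)) e) (at s)"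
    if "\<And>x. h differentiable (at x)" for h :: "real^3 \<Rightarrow> real" and s
  proof -
    have D: "(h has_derivative frechet_derivative h (at (s *\<^sub>R e))) (at (s *\<^sub>R e))"
      using that frechet_derivative_works by blast
    have "((\<lambda>s. s *\<^sub>R e) has_derivative (\<lambda>s. s *\<^sub>R e)) (at s)"
      by (auto intro!: derivative_eq_intros)
    from has_derivative_compose[OF this D]
    have "((\<lambda>s. h (s *\<^sub>R e)) has_derivative (\<lambda>k. frechet_derivative h (at (s *\<^sub>R e)) (k *\<^sub>R e))) (at s)" .
    moreover have "(\<lambda>k. frechet_derivative h (at (s *\<^sub>R e)) (k *\<^sub>R e)) =
        (*) (frechet_derivative h (at (s *\<^sub>R e)) e)"
      using linear_scale[OF has_derivative_linear[OF D]] by (auto simp: mult.commute)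
    ultimately show ?thesis by (simp add: has_field_derivative_def)
  qed
  have "(\<lambda>s. u \<bar>s\<bar>) = (\<lambda>s. f (s *\<^sub>R e))" by (simp add: f_def ne)
  with that line[OF d1] line[OF d2] show thesis by metis
qed

lemma has_real_derivative_even_primitive:
  fixes g :: "real \<Rightarrow> real"
  assumes cont: "continuous_on UNIV (\<lambda>s. g \<bar>s\<bar>)"
  shows "((\<lambda>\<sigma>. LINT \<rho>:{0..\<bar>\<sigma>\<bar>}|lebesgue. \<rho> * g \<rho>) has_real_derivative \<sigma> * g \<bar>\<sigma>\<bar>) (at \<sigma>)"
proof -
  define h where "h = (\<lambda>s. s * g \<bar>s\<bar>)"
  define N where "N = \<bar>\<sigma>\<bar> + 1"
  define A where "A = (\<lambda>x. integral {-N..x} h)"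
  have ch: "continuous_on S h" for S
    unfolding h_def
    by (intro continuous_intros continuous_on_subset[OF cont]) auto
  have A': "(A has_real_derivative h x) (at x)" if "-N < x" "x < N" for x
  proof -
    have "(A has_real_derivative h x) (at x within {-N..N})"
      unfolding A_def by (rule integral_has_real_derivative[OF ch]) (use that in auto)
    with that show ?thesis by (simp add: at_within_Icc_at)
  qed
  have LA: "(LINT \<rho>:{0..\<bar>s\<bar>}|lebesgue. \<rho> * g \<rho>) = A s - A 0" if s: "s \<in> {-N<..<N}" for s
  proof -
    have "(LINT \<rho>:{0..\<bar>s\<bar>}|lebesgue. \<rho> * g \<rho>) = (LINT \<rho>:{0..\<bar>s\<bar>}|lebesgue. h \<rho>)"
      by (rule set_lebesgue_integral_cong) (auto simp: h_def)
    also have "\<dots> = integral {0..\<bar>s\<bar>} h"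
      by (rule set_lebesgue_integral_eq_integral absolutely_integrable_continuous_real ch)+
    also have "\<dots> = A \<bar>s\<bar> - A 0"
    proof -
      have "integral {-N..0} h + integral {0..\<bar>s\<bar>} h = integral {-N..\<bar>s\<bar>} h"
        by (rule Henstock_Kurzweil_Integration.integral_combine)
           (auto simp: N_def intro!: integrable_continuous_real ch)
      thus ?thesis by (simp add: A_def)
    qed
    also have "A \<bar>s\<bar> = A s"
    proof -
      have "((\<lambda>x. A x - A (- x)) has_real_derivative 0) (at x within {-N<..<N})"
        if "x \<in> {-N<..<N}" for x
      proof -
        have "((\<lambda>x. A (- x)) has_real_derivative h (- x) * (-1)) (at x)"
          by (rule DERIV_chain2[OF A']) (use that in \<open>auto intro!: derivative_eq_intros\<close>)
        from DERIV_diff[OF A' this, of] that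
        have "((\<lambda>x. A x - A (- x)) has_real_derivative (h x + h (- x))) (at x)" by simp
        thus ?thesis by (auto simp: h_def intro: has_field_derivative_at_within)
      qed
      hence "\<exists>c. \<forall>x\<in>{-N<..<N}. A x - A (- x) = c"
        by (intro has_field_derivative_zero_constant) auto
      then obtain c where c: "\<And>x. x \<in> {-N<..<N} \<Longrightarrow> A x - A (- x) = c" by blast
      have "(0::real) \<in> {-N<..<N}" by (auto simp: N_def)
      from c[OF this] have "c = 0" by simp
      with c[OF s] show ?thesis by (auto simp: abs_if)
    qed
    finally show ?thesis .
  qed
  have "((\<lambda>s. A s - A 0) has_real_derivative h \<sigma>) (at \<sigma>)"
    using A'[of \<sigma>] by (auto simp: N_def intro!: derivative_eq_intros)
  hence "((\<lambda>\<sigma>. LINT \<rho>:{0..\<bar>\<sigma>\<bar>}|lebesgue. \<rho> * g \<rho>) has_real_derivative h \<sigma>) (at \<sigma>)"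
    by (rule has_field_derivative_transform_within_open[where S = "{-N<..<N}"])
       (use LA in \<open>auto simp: N_def\<close>)
  thus ?thesis by (simp add: h_def)
qed

text \<open>On radial functions of three variables, the Laplacian is \<open>\<partial>\<^sub>r\<^sup>2 + (2/r) \<partial>\<^sub>r\<close>.\<close>

lemma linear_wave_classical:
  assumes "radial_test v0" "radial_test v1"
  defines "v \<equiv> linear_wave v0 v1"
  obtains v_t v_tt v_r v_rr where
    "\<And>t r. r > 0 \<Longrightarrow> ((\<lambda>s. v s r) has_real_derivative v_t t r) (at t)"
    "\<And>t r. r > 0 \<Longrightarrow> ((\<lambda>s. v_t s r) has_real_derivative v_tt t r) (at t)"
    "\<And>t r. r > 0 \<Longrightarrow> ((\<lambda>s. v t s) has_real_derivative v_r t r) (at r)"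
    "\<And>t r. r > 0 \<Longrightarrow> ((\<lambda>s. v_r t s) has_real_derivative v_rr t r) (at r)"
    "\<And>t r. r > 0 \<Longrightarrow> v_tt t r = v_rr t r + 2 / r * v_r t r"
    "\<And>r. r > 0 \<Longrightarrow> v 0 r = v0 r"
    "\<And>r. r > 0 \<Longrightarrow> v_t 0 r = v1 r"
proof -
  obtain g g2 where g: "\<And>s. ((\<lambda>s. v0 \<bar>s\<bar>) has_real_derivative g s) (at s)"
      "\<And>s. (g has_real_derivative g2 s) (at s)"
    by (rule radial_test_even_extension[OF assms(1)]) (rule that)
  obtain k where k: "\<And>s. ((\<lambda>s. v1 \<bar>s\<bar>) has_real_derivative k s) (at s)"
    by (rule radial_test_even_extension[OF assms(2)]) (rule that)
  have cont: "continuous_on UNIV (\<lambda>s. v1 \<bar>s\<bar>)"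
    by (intro continuous_at_imp_continuous_on ballI DERIV_isCont[OF k])
  define F where "F = wave_F v0 v1"
  define F1 where "F1 = (\<lambda>s. 1/2 * (v0 \<bar>s\<bar> + s * g s) + 1/2 * (s * v1 \<bar>s\<bar>))"
  define F2 where "F2 = (\<lambda>s. 1/2 * (2 * g s + s * g2 s) + 1/2 * (v1 \<bar>s\<bar> + s * k s))"
  have F: "(F has_real_derivative F1 s) (at s)" for s
  proof -
    have "((\<lambda>s. s * v0 \<bar>s\<bar>) has_real_derivative v0 \<bar>s\<bar> + s * g s) (at s)"
      using DERIV_mult[OF DERIV_ident g(1)] by (simp add: mult.commute)
    from DERIV_add[OF DERIV_cmult[OF this] DERIV_cmult[OF has_real_derivative_even_primitive[OF cont]]]
    show ?thesis unfolding F_def F1_def wave_F_def [abs_def] mult.assoc .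
  qed
  have F1: "(F1 has_real_derivative F2 s) (at s)" for s
  proof -
    have "((\<lambda>s. s * g s) has_real_derivative g s + s * g2 s) (at s)"
      using DERIV_mult[OF DERIV_ident g(2)] by (simp add: mult.commute)
    moreover have "((\<lambda>s. s * v1 \<bar>s\<bar>) has_real_derivative v1 \<bar>s\<bar> + s * k s) (at s)"
      using DERIV_mult[OF DERIV_ident k] by (simp add: mult.commute)
    ultimately show ?thesis
      unfolding F1_def F2_def mult_2 add.assoc by (intro DERIV_add DERIV_cmult g)
  qed
  have g_odd: "g (- s) = - g s" for s
  proof -
    have "((\<lambda>x. v0 \<bar>- x\<bar>) has_real_derivative g (- s) * (-1)) (at s)"
      by (rule DERIV_chain2[where f = "\<lambda>x. v0 \<bar>x\<bar>", OF g(1)]) (auto intro!: derivative_eq_intros)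
    hence "((\<lambda>x. v0 \<bar>x\<bar>) has_real_derivative - g (- s)) (at s)" by simp
    from DERIV_unique[OF g(1) this] show ?thesis by simp
  qed
  have shift: "((\<lambda>s. H (s + c)) has_real_derivative H' (x + c)) (at x)"
      "((\<lambda>s. H (s - c)) has_real_derivative H' (x - c)) (at x)"
      "((\<lambda>s. H (c + s)) has_real_derivative H' (c + x)) (at x)"
      "((\<lambda>s. H (c - s)) has_real_derivative - H' (c - x)) (at x)"
    if H: "\<And>s. (H has_real_derivative H' s) (at s)" for H H' :: "real \<Rightarrow> real" and c x
  proof -
    have D: "((\<lambda>s. s + c) has_real_derivative 1) (at x)" "((\<lambda>s. s - c) has_real_derivative 1) (at x)"
      "((\<lambda>s. c + s) has_real_derivative 1) (at x)" "((\<lambda>s. c - s) has_real_derivative -1) (at x)"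
      by (auto intro!: derivative_eq_intros)
    show "((\<lambda>s. H (s + c)) has_real_derivative H' (x + c)) (at x)"
      "((\<lambda>s. H (s - c)) has_real_derivative H' (x - c)) (at x)"
      "((\<lambda>s. H (c + s)) has_real_derivative H' (c + x)) (at x)"
      "((\<lambda>s. H (c - s)) has_real_derivative - H' (c - x)) (at x)"
      using DERIV_chain2[OF H D(1)] DERIV_chain2[OF H D(2)] DERIV_chain2[OF H D(3)]
        DERIV_chain2[OF H D(4)] by simp_all
  qed
  show thesis
  proof (rule that[of
        "\<lambda>t r. (F1 (t + r) - F1 (t - r)) / r"
        "\<lambda>t r. (F2 (t + r) - F2 (t - r)) / r"
        "\<lambda>t r. (F1 (t + r) + F1 (t - r)) / r - (F (t + r) - F (t - r)) / r\<^sup>2"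
        "\<lambda>t r. (F2 (t + r) - F2 (t - r)) / r - 2 * (F1 (t + r) + F1 (t - r)) / r\<^sup>2
          + 2 * (F (t + r) - F (t - r)) / r^3"])
    fix t r :: real assume r: "r > 0"
    show "((\<lambda>s. v s r) has_real_derivative (F1 (t + r) - F1 (t - r)) / r) (at t)"
      unfolding v_def linear_wave_def F_def[symmetric]
      by (intro DERIV_cdivide DERIV_diff shift F)
    show "((\<lambda>s. (F1 (s + r) - F1 (s - r)) / r) has_real_derivative (F2 (t + r) - F2 (t - r)) / r) (at t)"
      by (intro DERIV_cdivide DERIV_diff shift F1)
    have N: "((\<lambda>s. F (t + s) - F (t - s)) has_real_derivative F1 (t + r) + F1 (t - r)) (at r)"
      using DERIV_diff[OF shift(3)[OF F] shift(4)[OF F]] by simp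
    have N1: "((\<lambda>s. F1 (t + s) + F1 (t - s)) has_real_derivative F2 (t + r) - F2 (t - r)) (at r)"
      using DERIV_add[OF shift(3)[OF F1] shift(4)[OF F1]] by simp
    have sq: "((\<lambda>s. s\<^sup>2) has_real_derivative 2 * r) (at r)"
      by (auto intro!: derivative_eq_intros)
    show "((\<lambda>s. v t s) has_real_derivative
        (F1 (t + r) + F1 (t - r)) / r - (F (t + r) - F (t - r)) / r\<^sup>2) (at r)"
      unfolding v_def linear_wave_def F_def[symmetric]
      by (rule DERIV_cong[OF DERIV_divide[OF N DERIV_ident]])
         (use r in \<open>simp_all add: field_simps power2_eq_square\<close>)
    show "((\<lambda>s. (F1 (t + s) + F1 (t - s)) / s - (F (t + s) - F (t - s)) / s\<^sup>2) has_real_derivative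
        (F2 (t + r) - F2 (t - r)) / r - 2 * (F1 (t + r) + F1 (t - r)) / r\<^sup>2
          + 2 * (F (t + r) - F (t - r)) / r^3) (at r)"
      by (rule DERIV_cong[OF DERIV_diff[OF DERIV_divide[OF N1 DERIV_ident] DERIV_divide[OF N sq]]])
         (use r in \<open>simp_all add: field_simps power2_eq_square power3_eq_cube\<close>)
    show "(F2 (t + r) - F2 (t - r)) / r =
        (F2 (t + r) - F2 (t - r)) / r - 2 * (F1 (t + r) + F1 (t - r)) / r\<^sup>2
          + 2 * (F (t + r) - F (t - r)) / r^3
        + 2 / r * ((F1 (t + r) + F1 (t - r)) / r - (F (t + r) - F (t - r)) / r\<^sup>2)"
      using r by (simp add: field_simps power2_eq_square power3_eq_cube)
  next
    fix r :: real assume r: "r > 0"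
    show "v 0 r = v0 r" using linear_wave_initial[OF r] by (simp add: v_def)
    show "(F1 (0 + r) - F1 (0 - r)) / r = v1 r"
      using r by (simp add: F1_def g_odd field_simps)
  qed
qed

end

theory Submission
  imports Defs
begin

text \<open>
  By d'Alembert's formula \<open>r * v(t,r)\<close> is the increment of \<open>F = wave_F v0 v1\<close> over the window
  \<open>(t - r, t + r)\<close>. The derivative of \<open>F\<close> at \<open>\<plusminus>s\<close> is, up to signs, half the sum of \<open>v0 s\<close>, \<open>s * v0' s\<close>
  and \<open>s * v1 s\<close>. The last two are in \<open>L\<^sup>m\<close> by hypothesis and the first by Hardy's inequality, because
  \<open>v0\<close> vanishes at infinity.
  So \<open>r * \<bar>v(t,r)\<bar> \<le> H(t,r)\<close>, the mass in the window of some \<open>f \<ge> 0\<close> whose \<open>L\<^sup>m\<close> norm \<open>N\<close> is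
  bounded by that of the data (\<open>wave_F_density\<close>).

  The inner integral in the \<open>S\<close> norm carries the exponent \<open>1/m\<close>. Since \<open>H(t,r)\<close> increases with \<open>r\<close>, this
  exponent can be removed: with \<open>q = 2 * m + 1\<close>, the inner quantity is at most a constant times
  \<open>\<integral> H(t,r) powr q * r powr (1/m - q) dr\<close> (\<open>nn_integral_powr_increasing\<close>). What is left is the bound of
  \<open>\<integral>\<integral> H powr q * r powr (1/m - q) dr dt\<close> by \<open>N powr q\<close> (\<open>nn_integral_window_mass_power\<close>).

  Every scale \<open>r\<close> contributes equally at the level of Young's inequality, so a bound scale by scale does not
  sum, and some interpolation is necessary. It is done by hand, as in Marcinkiewicz's theorem but
  with a threshold that depends on the scale: by Hoelder \<open>H(t,r) \<le> (2 * r) powr (1 - 1/m) * N\<close>, so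
  \<open>f\<close> is cut at the height \<open>N * r powr (-1/m)\<close>. On the low part Jensen's inequality replaces
  \<open>H powr q\<close> by the mass of \<open>f powr q\<close>; on the high part all powers but one of \<open>H\<close> are estimated by the uniform
  bound (\<open>window_mass_power_split\<close>). Integrating in \<open>t\<close> and then in \<open>r\<close>, both parts become,
  up to constants, \<open>N powr (m + 1)\<close> times the integral of \<open>f powr m\<close>.
\<close>

section \<open>Powers and the weighted Jensen inequality\<close>

lemma epowr_ennreal: "0 \<le> x \<Longrightarrow> epowr (ennreal x) p = ennreal (x powr p)"
  by (simp add: epowr_def)

lemma ennreal_finiteE:
  assumes "X \<noteq> \<infinity>"
  obtains x where "X = ennreal x" "0 \<le> x"
  using assms by (cases X) auto

lemma epowr_mono:
  assumes "x \<le> y" "0 \<le> p"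
  shows "epowr x p \<le> epowr y p"
proof (cases "y = \<infinity>")
  case False
  then have "x \<noteq> \<infinity>" using assms(1) by (auto simp: top_unique)
  then show ?thesis using False assms
    by (auto simp: epowr_def top.not_eq_extremum intro!: ennreal_leI powr_mono2 enn2real_mono)
qed (simp add: epowr_def)

lemma borel_measurable_epowr [measurable]:
  assumes [measurable]: "f \<in> borel_measurable M"
  shows "(\<lambda>x. epowr (f x) p) \<in> borel_measurable M"
  unfolding epowr_def by measurable

lemma epowr_le_powrD:
  assumes "epowr X p \<le> ennreal (y powr p)" "0 \<le> y" "0 < p"
  shows "X \<le> ennreal y"
proof -
  have "X \<noteq> \<infinity>" using assms(1) by (auto simp: epowr_def top_unique)
  then obtain x where x: "X = ennreal x" "0 \<le> x" by (rule ennreal_finiteE)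
  then have "x powr p \<le> y powr p" using assms by (simp add: epowr_ennreal)
  then have "x \<le> y" using x assms by (meson not_le powr_less_mono2)
  then show ?thesis using x by (simp add: ennreal_leI)
qed

lemma powr_above_tangent:
  fixes p k x :: real
  assumes "1 \<le> p" "0 < k" "0 \<le> x"
  shows "p * k powr (p - 1) * x \<le> x powr p + (p - 1) * k powr p"
proof (cases "x = 0")
  case False
  have "p * k powr (p - 1) * (x - k) \<le> x powr p - k powr p"
    by (rule convex_on_imp_above_tangent[where A = "{0<..}", OF powr_convex])
       (use assms False in \<open>auto simp: interior_open intro!: derivative_eq_intros\<close>)
  moreover have "k powr (p - 1) * k = k powr p"
    using assms by (simp add: powr_diff)
  then have "p * k powr (p - 1) * k = p * k powr p" by (simp add: mult.assoc)
  ultimately show ?thesis by (simp add: right_diff_distrib left_diff_distrib)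
qed (use assms in auto)

text \<open>
  Integrate the tangent inequality at height \<open>k\<close> against the weight and choose \<open>k\<close> to be the
  weighted mean of \<open>g\<close>. This one inequality serves as Hoelder's inequality on windows and, with a
  power weight, gives Hardy's inequality.
\<close>

lemma nn_integral_weighted_jensen:
  fixes g :: "'a \<Rightarrow> real" and w :: "'a \<Rightarrow> ennreal"
  assumes p: "1 \<le> p" and [measurable]: "g \<in> borel_measurable M" "w \<in> borel_measurable M"
    and g: "\<And>x. 0 \<le> g x" and w: "(\<integral>\<^sup>+x. w x \<partial>M) = ennreal c" and c: "0 \<le> c"
  shows "epowr (\<integral>\<^sup>+x. w x * ennreal (g x) \<partial>M) p
         \<le> ennreal (c powr (p - 1)) * (\<integral>\<^sup>+x. w x * ennreal (g x powr p) \<partial>M)"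
proof -
  let ?X = "\<integral>\<^sup>+x. w x * ennreal (g x) \<partial>M" and ?Y = "\<integral>\<^sup>+x. w x * ennreal (g x powr p) \<partial>M"
  have tangent: "ennreal (p * k powr (p - 1)) * ?X \<le> ?Y + ennreal ((p - 1) * k powr p * c)"
    if k: "0 < k" for k
  proof -
    have "ennreal (p * k powr (p - 1)) * ?X
        = (\<integral>\<^sup>+x. w x * ennreal (p * k powr (p - 1) * g x) \<partial>M)"
      using p g by (subst nn_integral_cmult[symmetric])
        (auto simp: ennreal_mult ac_simps intro!: nn_integral_cong)
    also have "\<dots> \<le> (\<integral>\<^sup>+x. w x * ennreal (g x powr p) + ennreal ((p - 1) * k powr p) * w x \<partial>M)"
    proof (rule nn_integral_mono)
      fix x
      have "w x * ennreal (p * k powr (p - 1) * g x)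
          \<le> w x * ennreal (g x powr p + (p - 1) * k powr p)"
        by (intro mult_left_mono ennreal_leI powr_above_tangent p k g) auto
      then show "w x * ennreal (p * k powr (p - 1) * g x)
          \<le> w x * ennreal (g x powr p) + ennreal ((p - 1) * k powr p) * w x"
        using p by (simp add: ennreal_plus distrib_left mult.commute)
    qed
    also have "\<dots> = ?Y + ennreal ((p - 1) * k powr p * c)"
      using p c by (simp add: nn_integral_add nn_integral_cmult w ennreal_mult)
    finally show ?thesis .
  qed
  show ?thesis
  proof (cases "c = 0 \<or> ?X = 0")
    case True
    have "?X = 0"
    proof (cases "c = 0")
      case True
      then have "AE x in M. w x = 0" using w by (simp add: nn_integral_0_iff_AE)
      then show ?thesis by (subst nn_integral_0_iff_AE) auto
    qed (use True in auto)
    then show ?thesis using epowr_ennreal[of 0 p] p by simp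
  next
    case False
    with c have c: "0 < c" and X0: "?X \<noteq> 0" by auto
    show ?thesis
    proof (cases "?Y = \<infinity>")
      case True
      then show ?thesis using c by (simp add: ennreal_mult_top)
    next
      case False
      then obtain y where y: "?Y = ennreal y" "0 \<le> y" by (rule ennreal_finiteE)
      have "?X \<noteq> \<infinity>"
        using tangent[of 1] p y c by (auto simp: ennreal_plus[symmetric] ennreal_mult_top top_unique
            simp del: ennreal_plus)
      then obtain x where x: "?X = ennreal x" "0 \<le> x" by (rule ennreal_finiteE)
      with X0 have x0: "0 < x" by (cases "x = 0") auto
      \<comment> \<open>the weighted mean of \<open>g\<close>, where the tangent gives the sharp bound\<close>
      define k where "k = x / c"
      have k: "0 < k" using x0 c by (simp add: k_def)
      have xk: "x = k * c" using c by (simp add: k_def)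
      have "p * k powr (p - 1) * x \<le> y + (p - 1) * k powr p * c"
        using tangent[OF k] p x y c k
        by (simp add: ennreal_plus[symmetric] ennreal_mult[symmetric] del: ennreal_plus)
      moreover have "k powr (p - 1) * x = k powr p * c"
        using k by (simp add: xk powr_diff)
      ultimately have "k powr p * c \<le> y" by (simp add: algebra_simps)
      then have "c powr (p - 1) * (k powr p * c) \<le> c powr (p - 1) * y"
        by (rule mult_left_mono) simp
      moreover have "x powr p = c powr (p - 1) * (k powr p * c)"
        using c k by (simp add: xk powr_mult powr_diff)
      ultimately have "x powr p \<le> c powr (p - 1) * y" by simp
      then show ?thesis using x y by (simp add: epowr_ennreal ennreal_mult[symmetric])
    qed
  qed
qed

section \<open>Hardy's inequality\<close>

lemma nn_integral_powr_tail:
  fixes a x :: real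
  assumes "0 < a" "0 < x"
  shows "(\<integral>\<^sup>+s\<in>{x<..}. ennreal (s powr (- a - 1)) \<partial>lborel) = ennreal (x powr (- a) / a)"
proof -
  have "((\<lambda>s. s powr (- a - 1)) has_integral - (x powr (- a - 1 + 1)) / (- a - 1 + 1)) {x..}"
    by (rule has_integral_powr_to_inf) (use assms in auto)
  from nn_integral_has_integral_lebesgue'[OF _ this]
  have "(\<integral>\<^sup>+s\<in>{x..}. ennreal (s powr (- a - 1)) \<partial>lborel) = ennreal (x powr (- a) / a)"
    by simp
  moreover have "(\<integral>\<^sup>+s\<in>{x<..}. ennreal (s powr (- a - 1)) \<partial>lborel)
      = (\<integral>\<^sup>+s\<in>{x..}. ennreal (s powr (- a - 1)) \<partial>lborel)"
    by (rule nn_integral_cong_AE, use AE_lborel_singleton[of x] in eventually_elim)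
       (auto simp: indicator_def)
  ultimately show ?thesis by simp
qed

lemma nn_integral_powr_initial:
  fixes b x :: real
  assumes "0 < b" "0 \<le> x"
  shows "(\<integral>\<^sup>+r\<in>{0<..x}. ennreal (r powr (b - 1)) \<partial>lborel) = ennreal (x powr b / b)"
proof -
  have "((\<lambda>s. s powr (b - 1)) has_integral (x powr (b - 1 + 1)) / (b - 1 + 1)) {0..x}"
    by (rule has_integral_powr_from_0) (use assms in auto)
  from nn_integral_has_integral_lebesgue'[OF _ this]
  have "(\<integral>\<^sup>+r\<in>{0..x}. ennreal (r powr (b - 1)) \<partial>lborel) = ennreal (x powr b / b)"
    by simp
  moreover have "(\<integral>\<^sup>+r\<in>{0<..x}. ennreal (r powr (b - 1)) \<partial>lborel)
      = (\<integral>\<^sup>+r\<in>{0..x}. ennreal (r powr (b - 1)) \<partial>lborel)"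
    by (rule nn_integral_cong_AE, use AE_lborel_singleton[of 0] in eventually_elim)
       (auto simp: indicator_def)
  ultimately show ?thesis by simp
qed

text \<open>
  Write \<open>g s / s\<close> as \<open>s powr (1/m) * g s\<close> times the weight \<open>s powr (-1/m - 1)\<close>, which has the finite
  mass \<open>m * r powr (-1/m)\<close> on \<open>{r<..}\<close>, and apply Jensen. The exponent \<open>1/m\<close> makes the remaining double
  integral converge in both variables. The pointwise bound also shows that the tail is finite.
\<close>

lemma hardy_tail:
  fixes g :: "real \<Rightarrow> real"
  assumes m: "1 < m" and [measurable]: "g \<in> borel_measurable borel" and g: "\<And>s. 0 \<le> g s"
    and r: "0 < r"
  shows "epowr (\<integral>\<^sup>+s\<in>{r<..}. ennreal (g s / s) \<partial>lborel) m
         \<le> ennreal (m powr (m - 1) * r powr (1 / m - 1))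
           * (\<integral>\<^sup>+s\<in>{r<..}. ennreal (s powr (- 1 / m) * g s powr m) \<partial>lborel)"
proof -
  let ?w = "\<lambda>s. ennreal (s powr (- (1 / m) - 1)) * indicator {r<..} s"
  have "epowr (\<integral>\<^sup>+s. ?w s * ennreal (\<bar>s\<bar> powr (1 / m) * g s) \<partial>lborel) m
     \<le> ennreal ((r powr - (1 / m) / (1 / m)) powr (m - 1))
        * (\<integral>\<^sup>+s. ?w s * ennreal ((\<bar>s\<bar> powr (1 / m) * g s) powr m) \<partial>lborel)"
    by (rule nn_integral_weighted_jensen)
       (use m r g nn_integral_powr_tail[of "1 / m" r] in auto)
  also have "(r powr - (1 / m) / (1 / m)) powr (m - 1) = m powr (m - 1) * r powr (1 / m - 1)"
    using m r by (simp add: powr_mult powr_powr diff_divide_distrib algebra_simps)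
  also have "(\<integral>\<^sup>+s. ?w s * ennreal ((\<bar>s\<bar> powr (1 / m) * g s) powr m) \<partial>lborel)
      = (\<integral>\<^sup>+s\<in>{r<..}. ennreal (s powr (- 1 / m) * g s powr m) \<partial>lborel)"
  proof (intro nn_integral_cong)
    fix s
    have "s powr (- (1 / m) - 1) * (s powr (1 / m) * g s) powr m = s powr (- 1 / m) * g s powr m"
      if "r < s"
    proof -
      have "(s powr (1 / m) * g s) powr m = s * g s powr m"
        using m r g that by (simp add: powr_mult powr_powr)
      moreover have "s powr (- (1 / m) - 1) * s = s powr (- 1 / m)"
        using r that by (simp add: powr_diff)
      ultimately show ?thesis by (simp add: mult.assoc[symmetric])
    qed
    then show "?w s * ennreal ((\<bar>s\<bar> powr (1 / m) * g s) powr m)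
        = ennreal (s powr (- 1 / m) * g s powr m) * indicator {r<..} s"
      using r by (auto simp: indicator_def ennreal_mult[symmetric])
  qed
  also have "(\<integral>\<^sup>+s. ?w s * ennreal (\<bar>s\<bar> powr (1 / m) * g s) \<partial>lborel)
      = (\<integral>\<^sup>+s\<in>{r<..}. ennreal (g s / s) \<partial>lborel)"
  proof (intro nn_integral_cong)
    fix s
    have "s powr (- (1 / m) - 1) * (s powr (1 / m) * g s) = g s / s" if "r < s"
      using r that by (simp add: mult.assoc[symmetric] powr_add[symmetric] powr_minus_divide)
    then show "?w s * ennreal (\<bar>s\<bar> powr (1 / m) * g s) = ennreal (g s / s) * indicator {r<..} s"
      using r g by (auto simp: indicator_def ennreal_mult[symmetric])
  qed
  finally show ?thesis .
qed

lemma hardy_inequality: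
  fixes g :: "real \<Rightarrow> real"
  assumes m: "1 < m" and [measurable]: "g \<in> borel_measurable borel" and g: "\<And>s. 0 \<le> g s"
  shows "(\<integral>\<^sup>+r\<in>{0<..}. epowr (\<integral>\<^sup>+s\<in>{r<..}. ennreal (g s / s) \<partial>lborel) m \<partial>lborel)
         \<le> ennreal (m powr m) * (\<integral>\<^sup>+s\<in>{0<..}. ennreal (g s powr m) \<partial>lborel)"
proof -
  let ?K = "\<lambda>r s. ennreal (m powr (m - 1) * r powr (1 / m - 1)) * indicator {0<..} r *
        (ennreal (s powr (- 1 / m) * g s powr m) * indicator {r<..} s)"
  have "(\<integral>\<^sup>+r\<in>{0<..}. epowr (\<integral>\<^sup>+s\<in>{r<..}. ennreal (g s / s) \<partial>lborel) m \<partial>lborel)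
      \<le> (\<integral>\<^sup>+r. (\<integral>\<^sup>+s. ?K r s \<partial>lborel) \<partial>lborel)"
  proof (intro nn_integral_mono)
    fix r :: real
    have "{s. r < s} = {r<..}" by auto
    show "epowr (\<integral>\<^sup>+s\<in>{r<..}. ennreal (g s / s) \<partial>lborel) m * indicator {0<..} r
        \<le> (\<integral>\<^sup>+s. ?K r s \<partial>lborel)"
      using hardy_tail[OF m _ g, where r = r]
      by (subst nn_integral_cmult) (auto simp: indicator_def)
  qed
  also have "\<dots> = (\<integral>\<^sup>+s. (\<integral>\<^sup>+r. ?K r s \<partial>lborel) \<partial>lborel)"
    unfolding indicator_def greaterThan_iff by (rule lborel_pair.Fubini') measurable
  also have "\<dots> \<le> (\<integral>\<^sup>+s. ennreal (m powr m) * (ennreal (g s powr m) * indicator {0<..} s) \<partial>lborel)"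
  proof (intro nn_integral_mono)
    fix s :: real
    show "(\<integral>\<^sup>+r. ?K r s \<partial>lborel) \<le> ennreal (m powr m) * (ennreal (g s powr m) * indicator {0<..} s)"
    proof (cases "0 < s")
      case True
      have "(\<integral>\<^sup>+r. ?K r s \<partial>lborel)
        \<le> (\<integral>\<^sup>+r. ennreal (m powr (m - 1) * (s powr (- 1 / m) * g s powr m)) *
              (ennreal (r powr (1 / m - 1)) * indicator {0<..s} r) \<partial>lborel)"
        by (intro nn_integral_mono)
           (auto simp: indicator_def ennreal_mult[symmetric] ac_simps split: if_splits)
      also have "\<dots> = ennreal (m powr (m - 1) * (s powr (- 1 / m) * g s powr m)) *
          ennreal (s powr (1 / m) / (1 / m))"
        using m True nn_integral_powr_initial[of "1 / m" s] by (subst nn_integral_cmult) auto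
      also have "\<dots> = ennreal (m powr m * g s powr m)"
      proof -
        have "s powr (- 1 / m) * s powr (1 / m) = 1"
          using True by (simp add: powr_add[symmetric])
        moreover have "m powr (m - 1) * m = m powr m" using m by (simp add: powr_diff)
        ultimately have "m powr (m - 1) * (s powr (- 1 / m) * g s powr m) * (s powr (1 / m) / (1 / m))
          = m powr m * g s powr m"
          by (metis (no_types, lifting) divide_divide_eq_right div_by_1 mult.commute mult.left_commute mult_1)
        then show ?thesis using m True by (simp add: ennreal_mult[symmetric])
      qed
      finally show ?thesis using True by (simp add: ennreal_mult)
    next
      case False
      then have "?K r s = 0" for r by (auto simp: indicator_def)
      then have "(\<integral>\<^sup>+r. ?K r s \<partial>lborel) = (\<integral>\<^sup>+r. 0 \<partial>(lborel :: real measure))"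
        by (intro nn_integral_cong)
      then show ?thesis by simp
    qed
  qed
  also have "\<dots> = ennreal (m powr m) * (\<integral>\<^sup>+s\<in>{0<..}. ennreal (g s powr m) \<partial>lborel)"
    by (rule nn_integral_cmult) simp
  finally show ?thesis .
qed

section \<open>Removing the exponent of the inner integral\<close>

text \<open>
  An increasing function is controlled at \<open>r\<close> by its integral beyond \<open>r\<close>, so
  \<open>h r * r powr (-a) \<le> a * I\<close>, where \<open>I\<close> is the integral on the right. Using this for all but one of the
  \<open>m\<close> factors bounds the integral on the left by \<open>(a * I) powr (m - 1) * I\<close>. This replaces a mixed
  norm by an integral over the half-plane, to which Tonelli's theorem applies.
\<close>

lemma nn_integral_powr_increasing:
  fixes h :: "real \<Rightarrow> real"
  assumes a: "0 < a" and m: "1 \<le> m" and h: "\<And>r. 0 < r \<Longrightarrow> 0 \<le> h r"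
    and [measurable]: "h \<in> borel_measurable borel"
    and mono: "\<And>r s. 0 < r \<Longrightarrow> r \<le> s \<Longrightarrow> h r \<le> h s"
  shows "epowr (\<integral>\<^sup>+r\<in>{0<..}. ennreal (h r powr m * r powr (- a * m - 1)) \<partial>lborel) (1 / m)
         \<le> ennreal (a powr (1 - 1 / m)) * (\<integral>\<^sup>+r\<in>{0<..}. ennreal (h r * r powr (- a - 1)) \<partial>lborel)"
proof -
  let ?I = "\<integral>\<^sup>+r\<in>{0<..}. ennreal (h r * r powr (- a - 1)) \<partial>lborel"
  show ?thesis
  proof (cases "?I = \<infinity>")
    case True
    then show ?thesis using a by (simp add: ennreal_mult_top)
  next
    case False
    then obtain I where I: "?I = ennreal I" "0 \<le> I" by (rule ennreal_finiteE)
    have tail: "h r * r powr (- a) \<le> a * I" if r: "0 < r" for r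
    proof -
      have "ennreal (h r * (r powr (- a) / a))
          = (\<integral>\<^sup>+s. ennreal (h r) * (ennreal (s powr (- a - 1)) * indicator {r<..} s) \<partial>lborel)"
        using a r h[OF r] nn_integral_powr_tail[OF a r]
        by (subst nn_integral_cmult) (auto simp: ennreal_mult[symmetric])
      also have "\<dots> \<le> ?I"
        using mono[OF r] h r
        by (intro nn_integral_mono)
           (auto simp: indicator_def ennreal_mult[symmetric] intro!: ennreal_leI mult_right_mono)
      finally show ?thesis using I a by (simp add: field_simps)
    qed
    have "(\<integral>\<^sup>+r\<in>{0<..}. ennreal (h r powr m * r powr (- a * m - 1)) \<partial>lborel)
        \<le> (\<integral>\<^sup>+r. ennreal ((a * I) powr (m - 1)) *
             (ennreal (h r * r powr (- a - 1)) * indicator {0<..} r) \<partial>lborel)"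
    proof (intro nn_integral_mono)
      fix r :: real
      have "h r powr m * r powr (- a * m - 1) \<le> (a * I) powr (m - 1) * (h r * r powr (- a - 1))"
        if r: "0 < r"
      proof -
        have "h r powr m * r powr (- a * m - 1)
            = (h r * r powr (- a)) powr (m - 1) * (h r * r powr (- a - 1))"
        proof (cases "h r = 0")
          case False
          have "h r powr m = h r powr (m - 1) * h r"
            using h[OF r] False by (simp add: powr_diff)
          moreover have "r powr (- a * m - 1) = (r powr (- a)) powr (m - 1) * r powr (- a - 1)"
          proof -
            have "- a * m - 1 = (- a) * (m - 1) + (- a - 1)" by (simp add: algebra_simps)
            then have "r powr (- a * m - 1) = r powr ((- a) * (m - 1) + (- a - 1))"
              by (rule arg_cong)
            also have "\<dots> = (r powr (- a)) powr (m - 1) * r powr (- a - 1)"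
              unfolding powr_add powr_powr ..
            finally show ?thesis .
          qed
          moreover have "(h r * r powr (- a)) powr (m - 1)
              = h r powr (m - 1) * (r powr (- a)) powr (m - 1)"
            by (rule powr_mult)
          ultimately show ?thesis by (simp only: ac_simps)
        qed simp
        also have "\<dots> \<le> (a * I) powr (m - 1) * (h r * r powr (- a - 1))"
          using tail[OF r] h[OF r] m by (intro mult_right_mono powr_mono2) auto
        finally show ?thesis .
      qed
      then show "ennreal (h r powr m * r powr (- a * m - 1)) * indicator {0<..} r
          \<le> ennreal ((a * I) powr (m - 1)) *
             (ennreal (h r * r powr (- a - 1)) * indicator {0<..} r)"
        using h by (auto simp: indicator_def ennreal_mult[symmetric] intro!: ennreal_leI)
    qed
    also have "\<dots> = ennreal ((a * I) powr (m - 1)) * ennreal I"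
      by (subst nn_integral_cmult) (auto simp: I)
    finally have "epowr (\<integral>\<^sup>+r\<in>{0<..}. ennreal (h r powr m * r powr (- a * m - 1)) \<partial>lborel) (1 / m)
        \<le> epowr (ennreal ((a * I) powr (m - 1) * I)) (1 / m)"
      using m I by (intro epowr_mono) (auto simp: ennreal_mult)
    also have "\<dots> = ennreal (((a * I) powr (m - 1) * I) powr (1 / m))"
      using I by (intro epowr_ennreal) auto
    also have "((a * I) powr (m - 1) * I) powr (1 / m) = a powr (1 - 1 / m) * I"
    proof (cases "I = 0")
      case False
      have "(a * I) powr (m - 1) * I = a powr (m - 1) * I powr m"
        using False I a by (simp add: powr_mult powr_diff)
      then show ?thesis
        using False I a m by (simp add: powr_mult powr_powr diff_divide_distrib powr_add[symmetric])
    qed simp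
    finally show ?thesis using I by (simp add: ennreal_mult)
  qed
qed

section \<open>Mass in a moving window\<close>

text \<open>
  Up to the factor \<open>2 * r\<close>, the average of \<open>f\<close> at scale \<open>r\<close> around \<open>t\<close>; the value is extended because
  \<open>f\<close> is not assumed to be integrable.
\<close>

definition window_mass :: "(real \<Rightarrow> real) \<Rightarrow> real \<Rightarrow> real \<Rightarrow> ennreal" where
  "window_mass f t r = (\<integral>\<^sup>+s\<in>{t - r<..<t + r}. ennreal (f s) \<partial>lborel)"

lemma borel_measurable_window_mass [measurable]:
  assumes [measurable]: "f \<in> borel_measurable borel" "a \<in> borel_measurable M" "b \<in> borel_measurable M"
  shows "(\<lambda>x. window_mass f (a x) (b x)) \<in> borel_measurable M"
  unfolding window_mass_def indicator_def greaterThanLessThan_iff by measurable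

lemma window_mass_holder:
  assumes p: "1 \<le> p" and [measurable]: "f \<in> borel_measurable borel" and f: "\<And>s. 0 \<le> f s" and r: "0 < r"
  shows "epowr (window_mass f t r) p
    \<le> ennreal ((2 * r) powr (p - 1)) * window_mass (\<lambda>s. f s powr p) t r"
proof -
  have "epowr (\<integral>\<^sup>+s. indicator {t - r<..<t + r} s * ennreal (f s) \<partial>lborel) p
    \<le> ennreal ((2 * r) powr (p - 1)) *
       (\<integral>\<^sup>+s. indicator {t - r<..<t + r} s * ennreal (f s powr p) \<partial>lborel)"
    by (rule nn_integral_weighted_jensen) (use p f r in auto)
  then show ?thesis by (simp add: window_mass_def mult.commute)
qed

lemma window_mass_le:
  assumes m: "1 < m" and f_meas [measurable]: "f \<in> borel_measurable borel" and f: "\<And>s. 0 \<le> f s"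
    and N: "0 \<le> N" "(\<integral>\<^sup>+s. ennreal (f s powr m) \<partial>lborel) \<le> ennreal (N powr m)" and r: "0 < r"
  shows "window_mass f t r \<le> ennreal ((2 * r) powr (1 - 1 / m) * N)"
proof (rule epowr_le_powrD)
  have "epowr (window_mass f t r) m
      \<le> ennreal ((2 * r) powr (m - 1)) * window_mass (\<lambda>s. f s powr m) t r"
    by (rule window_mass_holder) (use m f r in auto)
  also have "\<dots> \<le> ennreal ((2 * r) powr (m - 1)) * (\<integral>\<^sup>+s. ennreal (f s powr m) \<partial>lborel)"
    unfolding window_mass_def
    by (intro mult_left_mono nn_integral_mono) (auto simp: indicator_def)
  also have "\<dots> \<le> ennreal ((2 * r) powr (m - 1)) * ennreal (N powr m)"
    by (intro mult_left_mono N) auto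
  also have "\<dots> = ennreal (((2 * r) powr (1 - 1 / m) * N) powr m)"
    using m by (simp add: ennreal_mult[symmetric] powr_mult powr_powr left_diff_distrib)
  finally show "epowr (window_mass f t r) m \<le> ennreal (((2 * r) powr (1 - 1 / m) * N) powr m)" .
qed (use m N in auto)

text \<open>
  Tonelli: every point \<open>s\<close> lies in the window around \<open>t\<close> for a set of times \<open>t\<close> of length \<open>2 * r\<close>.
\<close>

lemma nn_integral_window_mass:
  assumes [measurable]: "f \<in> borel_measurable borel" and r: "0 < r"
  shows "(\<integral>\<^sup>+t. window_mass f t r \<partial>lborel) = ennreal (2 * r) * (\<integral>\<^sup>+s. ennreal (f s) \<partial>lborel)"
proof -
  have "(\<integral>\<^sup>+t. window_mass f t r \<partial>lborel)
      = (\<integral>\<^sup>+t. (\<integral>\<^sup>+s. ennreal (f s) * indicator {s - r<..<s + r} t \<partial>lborel) \<partial>lborel)"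
    unfolding window_mass_def
    by (intro nn_integral_cong) (auto simp: indicator_def intro!: arg_cong2[where f = "(*)"])
  also have "\<dots> = (\<integral>\<^sup>+s. (\<integral>\<^sup>+t. ennreal (f s) * indicator {s - r<..<s + r} t \<partial>lborel) \<partial>lborel)"
    unfolding indicator_def greaterThanLessThan_iff by (rule lborel_pair.Fubini') measurable
  also have "\<dots> = (\<integral>\<^sup>+s. ennreal (2 * r) * ennreal (f s) \<partial>lborel)"
    using r by (intro nn_integral_cong) (simp add: nn_integral_cmult_indicator mult.commute)
  also have "\<dots> = ennreal (2 * r) * (\<integral>\<^sup>+s. ennreal (f s) \<partial>lborel)"
    by (rule nn_integral_cmult) simp
  finally show ?thesis .
qed

lemma powr_add_le:
  fixes x y q :: real
  assumes "0 \<le> x" "0 \<le> y" "0 \<le> q"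
  shows "(x + y) powr q \<le> 2 powr q * (x powr q + y powr q)"
proof -
  have "(x + y) powr q \<le> (2 * max x y) powr q"
    using assms by (intro powr_mono2) auto
  also have "\<dots> = 2 powr q * max x y powr q" by (rule powr_mult)
  also have "\<dots> \<le> 2 powr q * (x powr q + y powr q)"
    by (intro mult_left_mono) (auto simp: max_def)
  finally show ?thesis .
qed

text \<open>
  At scale \<open>r\<close> the average of \<open>f\<close> is at most of order \<open>N * r powr (-1/m)\<close>, so \<open>f\<close> is cut at this height.
  On the low part all \<open>2 * m + 1\<close> powers are moved inside by Hoelder. On the high part \<open>2 * m\<close> of them are
  spent on the uniform bound, which leaves the first power.
\<close>

lemma window_mass_power_split:
  fixes f :: "real \<Rightarrow> real"
  assumes m: "1 < m" and f_meas [measurable]: "f \<in> borel_measurable borel" and f: "\<And>s. 0 \<le> f s"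
    and N: "0 < N" "(\<integral>\<^sup>+s. ennreal (f s powr m) \<partial>lborel) \<le> ennreal (N powr m)" and r: "0 < r"
  defines "low \<equiv> \<lambda>s. if f s \<le> N * r powr (- 1 / m) then f s powr (2 * m + 1) else 0"
    and "high \<equiv> \<lambda>s. if f s \<le> N * r powr (- 1 / m) then 0 else f s"
  shows "ennreal (enn2real (window_mass f t r) powr (2 * m + 1))
    \<le> ennreal (2 powr (2 * m + 1)) *
       (ennreal ((2 * r) powr (2 * m)) * window_mass low t r
        + ennreal ((2 * r) powr (2 * m - 2) * N powr (2 * m)) * window_mass high t r)"
proof -
  define f1 where "f1 = (\<lambda>s. if f s \<le> N * r powr (- 1 / m) then f s else 0)"
  have [measurable]: "f1 \<in> borel_measurable borel" "low \<in> borel_measurable borel"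
    "high \<in> borel_measurable borel"
    unfolding f1_def low_def high_def by measurable
  have low: "low = (\<lambda>s. f1 s powr (2 * m + 1))" by (auto simp: low_def f1_def)
  have sum: "window_mass f t r = window_mass f1 t r + window_mass high t r"
    unfolding window_mass_def using f
    by (subst nn_integral_add[symmetric])
       (auto simp: f1_def high_def indicator_def intro!: nn_integral_cong)
  define B where "B = (2 * r) powr (1 - 1 / m) * N"
  have total: "window_mass f t r \<le> ennreal B"
    unfolding B_def by (rule window_mass_le) (use m f N r in auto)
  have "window_mass f t r \<noteq> \<infinity>" using total by (auto simp: top_unique)
  then have "window_mass f1 t r \<noteq> \<infinity>" "window_mass high t r \<noteq> \<infinity>" by (auto simp: sum)
  then obtain x y where x: "window_mass f1 t r = ennreal x" "0 \<le> x"
    and y: "window_mass high t r = ennreal y" "0 \<le> y" by (metis ennreal_finiteE)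
  have yB: "y \<le> B" using total x y N by (simp add: sum B_def ennreal_plus[symmetric] del: ennreal_plus)
  have "enn2real (window_mass f t r) powr (2 * m + 1) \<le> 2 powr (2 * m + 1) * (x powr (2 * m + 1) + y powr (2 * m + 1))"
    using m x y powr_add_le[of x y "2 * m + 1"]
    by (simp add: sum ennreal_plus[symmetric] del: ennreal_plus)
  then have "ennreal (enn2real (window_mass f t r) powr (2 * m + 1))
      \<le> ennreal (2 powr (2 * m + 1)) * (ennreal (x powr (2 * m + 1)) + ennreal (y powr (2 * m + 1)))"
    by (simp add: ennreal_mult[symmetric] ennreal_plus[symmetric] ennreal_leI del: ennreal_plus)
  also have "ennreal (x powr (2 * m + 1)) \<le> ennreal ((2 * r) powr (2 * m)) * window_mass low t r"
    using window_mass_holder[of "2 * m + 1" f1 r t] m f r x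
    by (simp add: low f1_def epowr_ennreal)
  also have "ennreal (y powr (2 * m + 1))
      \<le> ennreal ((2 * r) powr (2 * m - 2) * N powr (2 * m)) * window_mass high t r"
  proof -
    have "y powr (2 * m + 1) = y powr (2 * m) * y"
      using y by (cases "y = 0") (auto simp: powr_add)
    also have "\<dots> \<le> B powr (2 * m) * y"
      using yB y m by (intro mult_right_mono powr_mono2) auto
    also have "B powr (2 * m) = (2 * r) powr (2 * m - 2) * N powr (2 * m)"
    proof -
      have "(1 - 1 / m) * (2 * m) = 2 * m - 2" using m by (simp add: field_simps)
      then show ?thesis by (simp only: B_def powr_mult powr_powr)
    qed
    finally show ?thesis using y by (simp add: ennreal_mult[symmetric] ennreal_leI)
  qed
  finally show ?thesis by (simp add: add_mono mult_left_mono)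
qed

section \<open>The space-time estimate\<close>

text \<open>
  The cut, seen for a fixed value \<open>y\<close> of \<open>f\<close>: \<open>y\<close> counts as low at the scales up to \<open>(N / y) powr m\<close>.
\<close>

lemma le_threshold_iff:
  fixes y N m r :: real
  assumes m: "1 < m" and N: "0 < N" and y: "0 < y" and r: "0 < r"
  shows "y \<le> N * r powr (- 1 / m) \<longleftrightarrow> r \<le> (N / y) powr m"
proof -
  have "y \<le> N * r powr (- 1 / m) \<longleftrightarrow> r powr (1 / m) \<le> N / y"
    using r y by (simp add: powr_minus field_simps)
  also have "\<dots> \<longleftrightarrow> (r powr (1 / m)) powr m \<le> (N / y) powr m"
  proof
    assume "(r powr (1 / m)) powr m \<le> (N / y) powr m"
    then show "r powr (1 / m) \<le> N / y"
      using powr_less_mono2[of m "N / y" "r powr (1 / m)"] y N m by (auto simp: not_le[symmetric])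
  qed (use m in \<open>auto intro: powr_mono2\<close>)
  finally show ?thesis using r m by (simp add: powr_powr)
qed

text \<open>
  The scales at which \<open>y\<close> is low are bounded and the exponent \<open>1/m\<close> is integrable at the origin, so that the
  exponent of \<open>y\<close> drops from \<open>2 * m + 1\<close> to \<open>m\<close>.
\<close>

lemma low_integral_radius:
  fixes y N m :: real
  assumes m: "1 < m" and N: "0 < N" and y: "0 \<le> y"
  shows "(\<integral>\<^sup>+r\<in>{0<..}. ennreal (r powr (1 / m) * (if y \<le> N * r powr (- 1 / m) then y powr (2 * m + 1) else 0)) \<partial>lborel)
    \<le> ennreal (N powr (m + 1) * y powr m)"
proof (cases "y = 0")
  case False
  define \<rho> where "\<rho> = (N / y) powr m"
  have y: "0 < y" using False y by simp
  have iff: "y \<le> N * r powr (- 1 / m) \<longleftrightarrow> r \<le> \<rho>" if "0 < r" for r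
    unfolding \<rho>_def using le_threshold_iff[OF m N y that] .
  have "(\<integral>\<^sup>+r\<in>{0<..}. ennreal (r powr (1 / m) * (if y \<le> N * r powr (- 1 / m) then y powr (2 * m + 1) else 0)) \<partial>lborel)
      = (\<integral>\<^sup>+r. ennreal (y powr (2 * m + 1)) * (ennreal (r powr (1 / m + 1 - 1)) * indicator {0<..\<rho>} r) \<partial>lborel)"
    using iff by (intro nn_integral_cong) (auto simp: indicator_def ennreal_mult[symmetric] mult.commute)
  also have "\<dots> = ennreal (y powr (2 * m + 1)) * ennreal (\<rho> powr (1 / m + 1) / (1 / m + 1))"
    using m nn_integral_powr_initial[of "1 / m + 1" \<rho>]
    by (subst nn_integral_cmult) (auto simp: \<rho>_def add_pos_pos)
  also have "\<dots> \<le> ennreal (y powr (2 * m + 1)) * ennreal (\<rho> powr (1 / m + 1))"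
  proof (intro mult_left_mono ennreal_leI)
    have "1 \<le> 1 / m + 1" using m by simp
    from divide_left_mono[OF this, of "\<rho> powr (1 / m + 1)"]
    show "\<rho> powr (1 / m + 1) / (1 / m + 1) \<le> \<rho> powr (1 / m + 1)" using m by (simp add: add_pos_pos)
  qed simp
  also have "\<dots> = ennreal (N powr (m + 1) * y powr m)"
  proof -
    have "m * (1 / m + 1) = m + 1" using m by (simp add: field_simps)
    then have "\<rho> powr (1 / m + 1) = (N / y) powr (m + 1)"
      by (simp only: \<rho>_def powr_powr)
    also have "\<dots> = N powr (m + 1) / y powr (m + 1)" using N y by (simp add: powr_divide)
    moreover have "y powr (2 * m + 1) = y powr (m + 1) * y powr m" by (simp add: powr_add[symmetric])
    ultimately show ?thesis using y by (simp add: ennreal_mult[symmetric])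
  qed
  finally show ?thesis .
qed (simp cong: if_cong)

text \<open>
  The scales at which \<open>y\<close> is high stay away from the origin and \<open>1/m - 2 < -1\<close>, so that the exponent of \<open>y\<close>
  rises from \<open>1\<close> to \<open>m\<close>.
\<close>

lemma high_integral_radius:
  fixes y N m :: real
  assumes m: "1 < m" and N: "0 < N" and y: "0 \<le> y"
  shows "(\<integral>\<^sup>+r\<in>{0<..}. ennreal (r powr (1 / m - 2) * (if y \<le> N * r powr (- 1 / m) then 0 else y)) \<partial>lborel)
    \<le> ennreal (m / (m - 1) * N powr (1 - m) * y powr m)"
proof (cases "y = 0")
  case False
  define \<rho> where "\<rho> = (N / y) powr m"
  have y: "0 < y" using False y by simp
  have iff: "y \<le> N * r powr (- 1 / m) \<longleftrightarrow> r \<le> \<rho>" if "0 < r" for r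
    unfolding \<rho>_def using le_threshold_iff[OF m N y that] .
  have \<rho>: "0 < \<rho>" using N y by (simp add: \<rho>_def)
  have "(\<integral>\<^sup>+r\<in>{0<..}. ennreal (r powr (1 / m - 2) * (if y \<le> N * r powr (- 1 / m) then 0 else y)) \<partial>lborel)
      = (\<integral>\<^sup>+r. ennreal y * (ennreal (r powr (- (1 - 1 / m) - 1)) * indicator {\<rho><..} r) \<partial>lborel)"
    using iff y \<rho> by (intro nn_integral_cong) (auto simp: indicator_def ennreal_mult[symmetric] mult.commute)
  also have "\<dots> = ennreal y * ennreal (\<rho> powr (- (1 - 1 / m)) / (1 - 1 / m))"
    using m \<rho> nn_integral_powr_tail[of "1 - 1 / m" \<rho>]
    by (subst nn_integral_cmult) auto
  also have "\<dots> = ennreal (m / (m - 1) * N powr (1 - m) * y powr m)"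
  proof -
    have "m * (- (1 - 1 / m)) = 1 - m" using m by (simp add: field_simps)
    then have "\<rho> powr (- (1 - 1 / m)) = (N / y) powr (1 - m)"
      by (simp only: \<rho>_def powr_powr)
    also have "\<dots> = N powr (1 - m) / y powr (1 - m)" using N y by (simp add: powr_divide)
    also have "\<dots> = N powr (1 - m) * (y powr m / y)" using y by (simp add: powr_diff)
    finally show ?thesis using y m by (simp add: ennreal_mult[symmetric] field_simps)
  qed
  finally show ?thesis by simp
qed (simp cong: if_cong)

text \<open>
  The split at scale \<open>r\<close>, integrated in time and multiplied by the weight in \<open>r\<close>; the time integration
  contributes the same factor \<open>2 * r\<close> to both parts.
\<close>

lemma nn_integral_time_window_mass_power:
  fixes f :: "real \<Rightarrow> real"
  assumes m: "1 < m" and f_meas [measurable]: "f \<in> borel_measurable borel" and f: "\<And>s. 0 \<le> f s"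
    and N: "0 < N" "(\<integral>\<^sup>+s. ennreal (f s powr m) \<partial>lborel) \<le> ennreal (N powr m)" and r: "0 < r"
  defines "low \<equiv> \<lambda>s. if f s \<le> N * r powr (- 1 / m) then f s powr (2 * m + 1) else 0"
    and "high \<equiv> \<lambda>s. if f s \<le> N * r powr (- 1 / m) then 0 else f s"
  shows "(\<integral>\<^sup>+t. ennreal (enn2real (window_mass f t r) powr (2 * m + 1) * r powr (1 / m - 2 * m - 1)) \<partial>lborel)
    \<le> ennreal (4 powr (2 * m + 1)) *
       (\<integral>\<^sup>+s. ennreal (r powr (1 / m) * low s)
          + ennreal (N powr (2 * m)) * ennreal (r powr (1 / m - 2) * high s) \<partial>lborel)"
proof -
  let ?q = "2 * m + 1"
  have [measurable]: "low \<in> borel_measurable borel" "high \<in> borel_measurable borel"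
    unfolding low_def high_def by measurable
  have nonneg: "0 \<le> low s" "0 \<le> high s" for s using f by (auto simp: low_def high_def)
  let ?w = "ennreal (r powr (1 / m - 2 * m - 1))"
  have "(\<integral>\<^sup>+t. ennreal (enn2real (window_mass f t r) powr ?q * r powr (1 / m - 2 * m - 1)) \<partial>lborel)
    \<le> (\<integral>\<^sup>+t. ?w * ennreal (2 powr ?q) * ennreal ((2 * r) powr (2 * m)) * window_mass low t r
        + ?w * ennreal (2 powr ?q) * ennreal ((2 * r) powr (2 * m - 2) * N powr (2 * m)) * window_mass high t r \<partial>lborel)"
  proof (rule nn_integral_mono)
    fix t
    have "?w * ennreal (enn2real (window_mass f t r) powr ?q) \<le> ?w * (ennreal (2 powr ?q) *
       (ennreal ((2 * r) powr (2 * m)) * window_mass low t r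
        + ennreal ((2 * r) powr (2 * m - 2) * N powr (2 * m)) * window_mass high t r))"
      unfolding low_def high_def
      by (intro mult_left_mono window_mass_power_split m f_meas f N r) auto
    then show "ennreal (enn2real (window_mass f t r) powr ?q * r powr (1 / m - 2 * m - 1))
      \<le> ?w * ennreal (2 powr ?q) * ennreal ((2 * r) powr (2 * m)) * window_mass low t r
        + ?w * ennreal (2 powr ?q) * ennreal ((2 * r) powr (2 * m - 2) * N powr (2 * m)) * window_mass high t r"
      by (simp add: ennreal_mult distrib_left mult.commute mult.left_commute mult.assoc)
  qed
  also have "\<dots> = ?w * ennreal (2 powr ?q) * ennreal ((2 * r) powr (2 * m)) * (ennreal (2 * r) * (\<integral>\<^sup>+s. ennreal (low s) \<partial>lborel))
        + ?w * ennreal (2 powr ?q) * ennreal ((2 * r) powr (2 * m - 2) * N powr (2 * m)) * (ennreal (2 * r) * (\<integral>\<^sup>+s. ennreal (high s) \<partial>lborel))"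
    using r by (simp add: nn_integral_add nn_integral_cmult nn_integral_window_mass)
  also have "?w * ennreal (2 powr ?q) * ennreal ((2 * r) powr (2 * m)) * (ennreal (2 * r) * (\<integral>\<^sup>+s. ennreal (low s) \<partial>lborel))
      = ennreal (4 powr ?q) * (ennreal (r powr (1 / m)) * (\<integral>\<^sup>+s. ennreal (low s) \<partial>lborel))"
  proof -
    have "(2 * r) powr (2 * m) * (2 * r) = (2 * r) powr ?q"
      using r by (simp add: powr_add)
    also have "\<dots> = 2 powr ?q * r powr ?q" by (rule powr_mult)
    finally have scale: "(2 * r) powr (2 * m) * (2 * r) = 2 powr ?q * r powr ?q" .
    have "r powr (1 / m - 2 * m - 1) * 2 powr ?q * (2 * r) powr (2 * m) * (2 * r)
      = r powr (1 / m - 2 * m - 1) * 2 powr ?q * ((2 * r) powr (2 * m) * (2 * r))"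
      by (rule mult.assoc)
    also have "\<dots> = (2 powr ?q * 2 powr ?q) * (r powr (1 / m - 2 * m - 1) * r powr ?q)"
      unfolding scale by (simp only: ac_simps)
    also have "2 powr ?q * 2 powr ?q = (4::real) powr ?q" by (simp add: powr_mult[symmetric])
    also have "r powr (1 / m - 2 * m - 1) * r powr ?q = r powr (1 / m)"
      by (simp add: powr_add[symmetric])
    finally have "?w * ennreal (2 powr ?q) * ennreal ((2 * r) powr (2 * m)) * ennreal (2 * r)
        = ennreal (4 powr ?q) * ennreal (r powr (1 / m))"
      using r by (simp add: ennreal_mult[symmetric])
    then show ?thesis by (metis mult.assoc)
  qed
  also have "?w * ennreal (2 powr ?q) * ennreal ((2 * r) powr (2 * m - 2) * N powr (2 * m)) * (ennreal (2 * r) * (\<integral>\<^sup>+s. ennreal (high s) \<partial>lborel))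
      \<le> ennreal (4 powr ?q) * (ennreal (N powr (2 * m)) * (ennreal (r powr (1 / m - 2)) * (\<integral>\<^sup>+s. ennreal (high s) \<partial>lborel)))"
  proof -
    have "(2 * r) powr (2 * m - 2) * (2 * r) = (2 * r) powr (2 * m - 1)"
      using r powr_add[of "2 * r" "2 * m - 2" 1] by simp
    also have "\<dots> = 2 powr (2 * m - 1) * r powr (2 * m - 1)" by (rule powr_mult)
    finally have scale: "(2 * r) powr (2 * m - 2) * (2 * r) = 2 powr (2 * m - 1) * r powr (2 * m - 1)" .
    have "r powr (1 / m - 2 * m - 1) * 2 powr ?q * ((2 * r) powr (2 * m - 2) * N powr (2 * m)) * (2 * r)
      = r powr (1 / m - 2 * m - 1) * 2 powr ?q * N powr (2 * m) * ((2 * r) powr (2 * m - 2) * (2 * r))"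
      by (simp only: ac_simps)
    also have "\<dots> = (2 powr ?q * 2 powr (2 * m - 1)) * (N powr (2 * m) * (r powr (1 / m - 2 * m - 1) * r powr (2 * m - 1)))"
      unfolding scale by (simp only: ac_simps)
    also have "r powr (1 / m - 2 * m - 1) * r powr (2 * m - 1) = r powr (1 / m - 2)"
      by (simp add: powr_add[symmetric])
    also have "(2 powr ?q * 2 powr (2 * m - 1)) * (N powr (2 * m) * r powr (1 / m - 2))
        \<le> (2 powr ?q * 2 powr ?q) * (N powr (2 * m) * r powr (1 / m - 2))"
      by (intro mult_right_mono mult_left_mono powr_mono) auto
    also have "2 powr ?q * 2 powr ?q = (4::real) powr ?q" by (simp add: powr_mult[symmetric])
    finally have "?w * ennreal (2 powr ?q) * ennreal ((2 * r) powr (2 * m - 2) * N powr (2 * m)) * ennreal (2 * r)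
        \<le> ennreal (4 powr ?q) * (ennreal (N powr (2 * m)) * ennreal (r powr (1 / m - 2)))"
      using r by (simp add: ennreal_mult[symmetric] ennreal_leI)
    then have "?w * ennreal (2 powr ?q) * ennreal ((2 * r) powr (2 * m - 2) * N powr (2 * m)) * ennreal (2 * r) * (\<integral>\<^sup>+s. ennreal (high s) \<partial>lborel)
        \<le> ennreal (4 powr ?q) * (ennreal (N powr (2 * m)) * ennreal (r powr (1 / m - 2))) * (\<integral>\<^sup>+s. ennreal (high s) \<partial>lborel)"
      by (rule mult_right_mono) simp
    then show ?thesis by (simp only: mult.assoc)
  qed
  finally show ?thesis using nonneg
    by (simp add: nn_integral_add nn_integral_cmult ennreal_mult distrib_left add_mono)
qed

text \<open>
  After Tonelli, the integral over \<open>r\<close> is done first for each fixed point \<open>s\<close>. Both parts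
  then give, up to constants, \<open>N powr (m + 1) * f s powr m\<close>, which is integrable in \<open>s\<close>.
\<close>

lemma nn_integral_window_mass_power:
  fixes f :: "real \<Rightarrow> real"
  assumes m: "1 < m" and f_meas [measurable]: "f \<in> borel_measurable borel" and f: "\<And>s. 0 \<le> f s"
    and N: "0 < N" "(\<integral>\<^sup>+s. ennreal (f s powr m) \<partial>lborel) \<le> ennreal (N powr m)"
  shows "(\<integral>\<^sup>+t. (\<integral>\<^sup>+r\<in>{0<..}. ennreal (enn2real (window_mass f t r) powr (2 * m + 1)
              * r powr (1 / m - 2 * m - 1)) \<partial>lborel) \<partial>lborel)
    \<le> ennreal (4 powr (2 * m + 1) * (1 + m / (m - 1)) * N powr (2 * m + 1))"
proof -
  let ?low = "\<lambda>r s. ennreal (r powr (1 / m) * (if f s \<le> N * r powr (- 1 / m) then f s powr (2 * m + 1) else 0))"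
  let ?high = "\<lambda>r s. ennreal (r powr (1 / m - 2) * (if f s \<le> N * r powr (- 1 / m) then 0 else f s))"
  have "(\<integral>\<^sup>+t. (\<integral>\<^sup>+r\<in>{0<..}. ennreal (enn2real (window_mass f t r) powr (2 * m + 1)
              * r powr (1 / m - 2 * m - 1)) \<partial>lborel) \<partial>lborel)
      = (\<integral>\<^sup>+r. (\<integral>\<^sup>+t. ennreal (enn2real (window_mass f t r) powr (2 * m + 1)
              * r powr (1 / m - 2 * m - 1)) * indicator {0<..} r \<partial>lborel) \<partial>lborel)"
    by (rule lborel_pair.Fubini') measurable
  also have "\<dots> \<le> (\<integral>\<^sup>+r. (\<integral>\<^sup>+s. ennreal (4 powr (2 * m + 1)) *
        (?low r s * indicator {0<..} r + ennreal (N powr (2 * m)) * (?high r s * indicator {0<..} r)) \<partial>lborel) \<partial>lborel)"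
  proof (rule nn_integral_mono)
    fix r :: real
    show "(\<integral>\<^sup>+t. ennreal (enn2real (window_mass f t r) powr (2 * m + 1)
              * r powr (1 / m - 2 * m - 1)) * indicator {0<..} r \<partial>lborel)
      \<le> (\<integral>\<^sup>+s. ennreal (4 powr (2 * m + 1)) *
        (?low r s * indicator {0<..} r + ennreal (N powr (2 * m)) * (?high r s * indicator {0<..} r)) \<partial>lborel)"
      using nn_integral_time_window_mass_power[OF m f_meas f N, of r]
      by (cases "0 < r") (auto simp: nn_integral_cmult)
  qed
  also have "\<dots> = (\<integral>\<^sup>+s. (\<integral>\<^sup>+r. ennreal (4 powr (2 * m + 1)) *
        (?low r s * indicator {0<..} r + ennreal (N powr (2 * m)) * (?high r s * indicator {0<..} r)) \<partial>lborel) \<partial>lborel)"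
    by (rule lborel_pair.Fubini') measurable
  also have "\<dots> \<le> (\<integral>\<^sup>+s. ennreal (4 powr (2 * m + 1) * ((1 + m / (m - 1)) * N powr (m + 1))) * ennreal (f s powr m) \<partial>lborel)"
  proof (rule nn_integral_mono)
    fix s :: real
    have "(\<integral>\<^sup>+r. ennreal (4 powr (2 * m + 1)) *
        (?low r s * indicator {0<..} r + ennreal (N powr (2 * m)) * (?high r s * indicator {0<..} r)) \<partial>lborel)
      = ennreal (4 powr (2 * m + 1)) *
        ((\<integral>\<^sup>+r. ?low r s * indicator {0<..} r \<partial>lborel) +
          ennreal (N powr (2 * m)) * (\<integral>\<^sup>+r. ?high r s * indicator {0<..} r \<partial>lborel))"
      by (simp add: nn_integral_cmult nn_integral_add)
    also have "\<dots> \<le> ennreal (4 powr (2 * m + 1)) * (ennreal (N powr (m + 1) * f s powr m)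
        + ennreal (N powr (2 * m)) * ennreal (m / (m - 1) * N powr (1 - m) * f s powr m))"
      using low_integral_radius[OF m N(1) f, of s] high_integral_radius[OF m N(1) f, of s]
      by (intro mult_left_mono add_mono) auto
    also have "\<dots> = ennreal (4 powr (2 * m + 1) * ((1 + m / (m - 1)) * N powr (m + 1))) * ennreal (f s powr m)"
    proof -
      have "N powr (2 * m) * N powr (1 - m) = N powr (m + 1)"
        by (simp add: powr_add[symmetric])
      then have "N powr (2 * m) * (m / (m - 1) * N powr (1 - m) * f s powr m)
          = m / (m - 1) * N powr (m + 1) * f s powr m"
        by (metis mult.assoc mult.left_commute)
      then show ?thesis using m
        by (simp add: ennreal_mult[symmetric] ennreal_plus[symmetric] algebra_simps del: ennreal_plus)
    qed
    finally show "(\<integral>\<^sup>+r. ennreal (4 powr (2 * m + 1)) *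
        (?low r s * indicator {0<..} r + ennreal (N powr (2 * m)) * (?high r s * indicator {0<..} r)) \<partial>lborel)
      \<le> ennreal (4 powr (2 * m + 1) * ((1 + m / (m - 1)) * N powr (m + 1))) * ennreal (f s powr m)" .
  qed
  also have "\<dots> = ennreal (4 powr (2 * m + 1) * ((1 + m / (m - 1)) * N powr (m + 1))) * (\<integral>\<^sup>+s. ennreal (f s powr m) \<partial>lborel)"
    by (rule nn_integral_cmult) simp
  also have "\<dots> \<le> ennreal (4 powr (2 * m + 1) * ((1 + m / (m - 1)) * N powr (m + 1))) * ennreal (N powr m)"
    by (intro mult_left_mono N) simp
  also have "\<dots> = ennreal (4 powr (2 * m + 1) * (1 + m / (m - 1)) * N powr (2 * m + 1))"
  proof -
    have "N powr (m + 1) * N powr m = N powr (2 * m + 1)" by (simp add: powr_add[symmetric])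
    then show ?thesis using m by (simp add: ennreal_mult[symmetric] mult.assoc)
  qed
  finally show ?thesis .
qed

section \<open>The derivative of d'Alembert's primitive\<close>

lemma borel_version_abs:
  fixes u :: "real \<Rightarrow> real"
  assumes "(\<lambda>x. indicator {0<..} x * u x) \<in> borel_measurable lebesgue"
  obtains g where "g \<in> borel_measurable borel" "\<And>x. 0 \<le> g x" "AE x in lborel. 0 < x \<longrightarrow> g x = \<bar>u x\<bar>"
proof -
  obtain g where g: "g \<in> borel_measurable lborel"
    and ae: "AE x in lborel. indicator {0<..} x * u x = g x"
    using completion_ex_borel_measurable_real[OF assms] by blast
  show thesis
  proof
    show "(\<lambda>x. \<bar>g x\<bar>) \<in> borel_measurable borel" using g by simp
    show "AE x in lborel. 0 < x \<longrightarrow> \<bar>g x\<bar> = \<bar>u x\<bar>"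
      using ae by eventually_elim auto
  qed simp
qed

lemma loc_abs_cont_deriv_measurable:
  assumes "loc_abs_cont u"
  shows "(\<lambda>x. indicator {0<..} x * deriv u x) \<in> borel_measurable lebesgue"
proof (rule borel_measurable_LIMSEQ_real)
  let ?A = "\<lambda>n. {1 / real (Suc n)..real (Suc n)}"
  fix n
  have "1 / real (Suc n) \<le> real (Suc n)"
    by (rule order_trans[of _ 1]) auto
  then have "deriv u absolutely_integrable_on ?A n"
    using assms by (auto simp: loc_abs_cont_def)
  then have "(\<lambda>x. indicator (?A n) x *\<^sub>R deriv u x) \<in> borel_measurable lebesgue"
    unfolding set_integrable_def by (rule borel_measurable_integrable)
  then show "(\<lambda>x. indicator (?A n) x * deriv u x) \<in> borel_measurable lebesgue" by simp
next
  let ?A = "\<lambda>n. {1 / real (Suc n)..real (Suc n)}"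
  fix x :: real
  show "(\<lambda>n. indicator (?A n) x * deriv u x) \<longlonglongrightarrow> indicator {0<..} x * deriv u x"
  proof (cases "0 < x")
    case True
    obtain n0 where n0: "max x (1 / x) \<le> real n0" using real_arch_simple by blast
    have "eventually (\<lambda>n. indicator (?A n) x * deriv u x = indicator {0<..} x * deriv u x) sequentially"
      using eventually_ge_at_top[of n0]
    proof eventually_elim
      case (elim n)
      with n0 have n: "x \<le> real (Suc n)" "1 / x \<le> real (Suc n)" by auto
      then have "x \<in> ?A n" using True by (auto simp: field_simps simp del: of_nat_Suc)
      then show ?case using True by simp
    qed
    then show ?thesis by (rule tendsto_eventually)
  next
    case False
    have "indicator (?A n) x = (0::real)" for n
    proof -
      have "0 < 1 / real (Suc n)" by simp
      with False have "x < 1 / real (Suc n)" by linarith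
      then have "x \<notin> ?A n" unfolding atLeastAtMost_iff by linarith
      then show ?thesis by (rule indicator_simps(2))
    qed
    then show ?thesis using False by simp
  qed
qed

lemma loc_abs_cont_increment:
  assumes u: "loc_abs_cont u" and [measurable]: "g \<in> borel_measurable borel"
    and g: "AE x in lborel. 0 < x \<longrightarrow> g x = \<bar>deriv u x\<bar>" and xy: "0 < x" "x \<le> y"
  shows "ennreal \<bar>u y - u x\<bar> \<le> (\<integral>\<^sup>+s\<in>{x<..<y}. ennreal (g s) \<partial>lborel)"
proof -
  have ai: "deriv u absolutely_integrable_on {x..y}" and eq: "u y - u x = integral {x..y} (deriv u)"
    using u xy by (auto simp: loc_abs_cont_def)
  have "u y - u x = (\<integral>s. indicator {x..y} s *\<^sub>R deriv u s \<partial>lebesgue)"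
    using set_lebesgue_integral_eq_integral(2)[OF ai] eq by (simp add: set_lebesgue_integral_def)
  then have "ennreal \<bar>u y - u x\<bar> \<le> (\<integral>\<^sup>+s. norm (indicator {x..y} s *\<^sub>R deriv u s) \<partial>lebesgue)"
    using integral_norm_bound_ennreal[of lebesgue "\<lambda>s. indicator {x..y} s *\<^sub>R deriv u s"] ai
    by (simp add: set_integrable_def)
  also have "\<dots> = (\<integral>\<^sup>+s. norm (indicator {x..y} s *\<^sub>R deriv u s) \<partial>lborel)"
    by (rule nn_integral_completion)
  also have "\<dots> = (\<integral>\<^sup>+s\<in>{x<..<y}. ennreal (g s) \<partial>lborel)"
  proof (rule nn_integral_cong_AE)
    show "AE s in lborel. ennreal (norm (indicator {x..y} s *\<^sub>R deriv u s)) = ennreal (g s) * indicator {x<..<y} s"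
      using g AE_lborel_singleton[of x] AE_lborel_singleton[of y]
      by eventually_elim (use xy in \<open>auto simp: indicator_def\<close>)
  qed
  finally show ?thesis .
qed

text \<open>
  Decay at infinity fixes the additive constant in \<open>u\<close>, so that the variation beyond \<open>x\<close> bounds \<open>u x\<close> itself.
\<close>

lemma abs_le_tail_variation:
  fixes u g :: "real \<Rightarrow> real"
  assumes inc: "\<And>y. x \<le> y \<Longrightarrow> ennreal \<bar>u y - u x\<bar> \<le> (\<integral>\<^sup>+s\<in>{x<..<y}. ennreal (g s) \<partial>lborel)"
    and lim: "(u \<longlongrightarrow> 0) at_top"
  shows "ennreal \<bar>u x\<bar> \<le> (\<integral>\<^sup>+s\<in>{x<..}. ennreal (g s) \<partial>lborel)"
proof (cases "(\<integral>\<^sup>+s\<in>{x<..}. ennreal (g s) \<partial>lborel) = \<infinity>")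
  case False
  then obtain T where T: "(\<integral>\<^sup>+s\<in>{x<..}. ennreal (g s) \<partial>lborel) = ennreal T" "0 \<le> T"
    by (rule ennreal_finiteE)
  have bound: "\<bar>u y - u x\<bar> \<le> T" if "x \<le> y" for y
  proof -
    have "ennreal \<bar>u y - u x\<bar> \<le> (\<integral>\<^sup>+s\<in>{x<..<y}. ennreal (g s) \<partial>lborel)" by (rule inc) fact
    also have "\<dots> \<le> (\<integral>\<^sup>+s\<in>{x<..}. ennreal (g s) \<partial>lborel)"
      by (intro nn_integral_mono) (auto simp: indicator_def)
    finally show ?thesis using T by simp
  qed
  have "((\<lambda>y. \<bar>u y - u x\<bar>) \<longlongrightarrow> \<bar>0 - u x\<bar>) at_top"
    by (intro tendsto_intros lim)
  moreover have "eventually (\<lambda>y. \<bar>u y - u x\<bar> \<le> T) at_top"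
    using eventually_ge_at_top[of x] by eventually_elim (rule bound)
  ultimately have "\<bar>0 - u x\<bar> \<le> T"
    by (rule tendsto_upperbound) simp
  then show ?thesis using T by (simp add: ennreal_leI)
qed simp

text \<open>
  A substitute for integrating the product rule \<open>(s * u s)' = u s + s * u' s\<close>: because the majorant \<open>G\<close> of \<open>u\<close>
  is decreasing, the decomposition \<open>(b - a) * u b + a * (u b - u a)\<close> of the increment is bounded by
  integrals over the interval. The case \<open>a = 0\<close> is included although \<open>u\<close> may be unbounded near \<open>0\<close>.
\<close>

lemma radius_times_increment:
  fixes u g G :: "real \<Rightarrow> real"
  assumes [measurable]: "g \<in> borel_measurable borel" "G \<in> borel_measurable borel"
    and nonneg: "\<And>x. 0 \<le> g x" "\<And>x. 0 \<le> G x"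
    and inc: "\<And>x y. 0 < x \<Longrightarrow> x \<le> y \<Longrightarrow> ennreal \<bar>u y - u x\<bar> \<le> (\<integral>\<^sup>+s\<in>{x<..<y}. ennreal (g s) \<partial>lborel)"
    and le: "\<And>x. 0 < x \<Longrightarrow> \<bar>u x\<bar> \<le> G x"
    and anti: "\<And>x y. 0 < x \<Longrightarrow> x \<le> y \<Longrightarrow> G y \<le> G x"
    and ab: "0 \<le> a" "a \<le> b"
  shows "ennreal \<bar>b * u b - a * u a\<bar>
    \<le> (\<integral>\<^sup>+s\<in>{a<..<b}. ennreal (G s) \<partial>lborel) + (\<integral>\<^sup>+s\<in>{a<..<b}. ennreal (\<bar>s\<bar> * g s) \<partial>lborel)"
proof (cases "a = b")
  case False
  with ab have b: "0 < b" "a < b" by auto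
  have "b * u b - a * u a = (b - a) * u b + a * (u b - u a)" by (simp add: algebra_simps)
  then have "\<bar>b * u b - a * u a\<bar> \<le> \<bar>(b - a) * u b\<bar> + \<bar>a * (u b - u a)\<bar>"
    by (simp only: abs_triangle_ineq)
  also have "\<dots> = (b - a) * \<bar>u b\<bar> + a * \<bar>u b - u a\<bar>"
    using ab by (simp add: abs_mult)
  also have "\<dots> \<le> (b - a) * G b + a * \<bar>u b - u a\<bar>"
    using ab le[OF b(1)] by (intro add_right_mono mult_left_mono) auto
  finally have "ennreal \<bar>b * u b - a * u a\<bar> \<le> ennreal ((b - a) * G b) + ennreal (a * \<bar>u b - u a\<bar>)"
    using ab nonneg by (simp add: ennreal_plus[symmetric] ennreal_leI del: ennreal_plus)
  also have "ennreal ((b - a) * G b) = (\<integral>\<^sup>+s. ennreal (G b) * indicator {a<..<b} s \<partial>lborel)"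
    using ab nonneg by (simp add: nn_integral_cmult_indicator ennreal_mult mult.commute)
  also have "\<dots> \<le> (\<integral>\<^sup>+s\<in>{a<..<b}. ennreal (G s) \<partial>lborel)"
    using ab anti by (intro nn_integral_mono) (auto simp: indicator_def intro!: ennreal_leI)
  also have "ennreal (a * \<bar>u b - u a\<bar>) \<le> (\<integral>\<^sup>+s\<in>{a<..<b}. ennreal (\<bar>s\<bar> * g s) \<partial>lborel)"
  proof (cases "a = 0")
    case False
    then have "ennreal (a * \<bar>u b - u a\<bar>) \<le> ennreal a * (\<integral>\<^sup>+s\<in>{a<..<b}. ennreal (g s) \<partial>lborel)"
      using ab by (auto simp: ennreal_mult intro!: mult_left_mono inc)
    also have "\<dots> = (\<integral>\<^sup>+s. ennreal a * (ennreal (g s) * indicator {a<..<b} s) \<partial>lborel)"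
      by (subst nn_integral_cmult) auto
    also have "\<dots> \<le> (\<integral>\<^sup>+s\<in>{a<..<b}. ennreal (\<bar>s\<bar> * g s) \<partial>lborel)"
      using ab nonneg
      by (intro nn_integral_mono)
         (auto simp: indicator_def ennreal_mult[symmetric] intro!: ennreal_leI mult_right_mono)
    finally show ?thesis .
  qed simp
  finally show ?thesis by (simp add: add_mono)
qed simp

lemma set_integral_increment:
  fixes h k :: "real \<Rightarrow> real"
  assumes int: "\<And>x. 0 \<le> x \<Longrightarrow> set_integrable lebesgue {0..x} h"
    and k: "AE s in lborel. 0 < s \<longrightarrow> k s = \<bar>h s\<bar>" and ab: "0 \<le> a" "a \<le> b"
  shows "ennreal \<bar>(LINT s:{0..b}|lebesgue. h s) - (LINT s:{0..a}|lebesgue. h s)\<bar>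
    \<le> (\<integral>\<^sup>+s\<in>{a<..<b}. ennreal (k s) \<partial>lborel)"
proof -
  let ?d = "\<lambda>s. indicator {0..b} s *\<^sub>R h s - indicator {0..a} s *\<^sub>R h s"
  have i: "integrable lebesgue (\<lambda>s. indicator {0..b} s *\<^sub>R h s)"
    "integrable lebesgue (\<lambda>s. indicator {0..a} s *\<^sub>R h s)"
    using int[of a] int[of b] ab by (auto simp: set_integrable_def)
  have "(LINT s:{0..b}|lebesgue. h s) - (LINT s:{0..a}|lebesgue. h s) = integral\<^sup>L lebesgue ?d"
    using i by (simp add: set_lebesgue_integral_def)
  then have "ennreal \<bar>(LINT s:{0..b}|lebesgue. h s) - (LINT s:{0..a}|lebesgue. h s)\<bar>
      \<le> (\<integral>\<^sup>+s. norm (?d s) \<partial>lebesgue)"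
    using integral_norm_bound_ennreal[of lebesgue ?d] Bochner_Integration.integrable_diff[OF i] by simp
  also have "\<dots> = (\<integral>\<^sup>+s. norm (?d s) \<partial>lborel)"
    by (rule nn_integral_completion)
  also have "\<dots> = (\<integral>\<^sup>+s\<in>{a<..<b}. ennreal (k s) \<partial>lborel)"
  proof (rule nn_integral_cong_AE)
    show "AE s in lborel. ennreal (norm (?d s)) = ennreal (k s) * indicator {a<..<b} s"
      using k AE_lborel_singleton[of a] AE_lborel_singleton[of b]
      by eventually_elim (use ab in \<open>auto simp: indicator_def\<close>)
  qed
  finally show ?thesis .
qed

lemma nn_integral_even_interval:
  fixes k :: "real \<Rightarrow> ennreal"
  assumes [measurable]: "k \<in> borel_measurable borel"
  shows "(\<integral>\<^sup>+s\<in>{- b<..<- a}. k \<bar>s\<bar> \<partial>lborel) = (\<integral>\<^sup>+s\<in>{a<..<b}. k \<bar>s\<bar> \<partial>lborel)"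
  by (subst nn_integral_real_affine[where c = "-1" and t = 0])
     (auto intro!: nn_integral_cong simp: indicator_def)

lemma nn_integral_even:
  fixes k :: "real \<Rightarrow> ennreal"
  assumes [measurable]: "k \<in> borel_measurable borel"
  shows "(\<integral>\<^sup>+s. k \<bar>s\<bar> \<partial>lborel) = 2 * (\<integral>\<^sup>+s\<in>{0<..}. k s \<partial>lborel)"
proof -
  have "(\<integral>\<^sup>+s. k \<bar>s\<bar> \<partial>lborel) = (\<integral>\<^sup>+s. k s * indicator {0<..} s + k (- s) * indicator {..<0} s \<partial>lborel)"
    by (rule nn_integral_cong_AE, use AE_lborel_singleton[of 0] in eventually_elim)
       (auto simp: indicator_def)
  also have "\<dots> = (\<integral>\<^sup>+s. k s * indicator {0<..} s \<partial>lborel) + (\<integral>\<^sup>+s. k (- s) * indicator {..<0} s \<partial>lborel)"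
    by (rule nn_integral_add) measurable
  also have "(\<integral>\<^sup>+s. k (- s) * indicator {..<0} s \<partial>lborel) = (\<integral>\<^sup>+s. k s * indicator {0<..} s \<partial>lborel)"
    by (subst nn_integral_real_affine[where c = "-1" and t = 0])
       (auto intro!: nn_integral_cong simp: indicator_def)
  finally show ?thesis by (simp add: mult_2)
qed

text \<open>
  The factors come from the two half-lines, the three summands of the density, Hardy's inequality,
  and the norm of the data.
\<close>

definition density_const :: "real \<Rightarrow> real" where
  "density_const m = 2 * (3 powr m * (m powr m + 1))"

lemma powr_add3_le:
  fixes x y z m :: real
  assumes "0 \<le> x" "0 \<le> y" "0 \<le> z" "0 \<le> m"
  shows "(x + y + z) powr m \<le> 3 powr m * (x powr m + y powr m + z powr m)"
proof -
  let ?M = "max x (max y z)"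
  have "(x + y + z) powr m \<le> (3 * ?M) powr m"
    using assms by (intro powr_mono2) auto
  also have "\<dots> = 3 powr m * ?M powr m" by (rule powr_mult)
  also have "\<dots> \<le> 3 powr m * (x powr m + y powr m + z powr m)"
    by (intro mult_left_mono) (auto simp: max_def)
  finally show ?thesis .
qed

lemma Lm_norm_integral:
  assumes m: "1 < m" and l: "Lm_norm m v0 v1 = ennreal l" "0 \<le> l"
  shows "(\<integral>\<^sup>+ r \<in> {0<..}. ennreal (\<bar>r * deriv v0 r\<bar> powr m + \<bar>r * v1 r\<bar> powr m) \<partial>lborel) = ennreal (l powr m)"
proof -
  let ?A = "\<integral>\<^sup>+ r \<in> {0<..}. ennreal (\<bar>r * deriv v0 r\<bar> powr m + \<bar>r * v1 r\<bar> powr m) \<partial>lborel"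
  have eq: "epowr ?A (1 / m) = ennreal l"
    using l(1) by (simp add: Lm_norm_def nn_integral_completion)
  then have "?A \<noteq> \<infinity>" by (auto simp: epowr_def)
  then obtain a where a: "?A = ennreal a" "0 \<le> a" by (rule ennreal_finiteE)
  with eq l have "a powr (1 / m) = l" by (simp add: epowr_ennreal)
  then have "a = l powr m" using m a by (auto simp: powr_powr)
  with a show ?thesis by simp
qed

text \<open>
  The density \<open>f\<close> is a Borel majorant of the derivative of \<open>wave_F v0 v1\<close>. It is even, because the summand of
  \<open>wave_F\<close> coming from \<open>v0\<close> is odd and the one coming from \<open>v1\<close> is even; so it is enough to construct it and
  to bound increments on the half-line \<open>s \<ge> 0\<close>.
  It is half the sum of the tail variation of \<open>v0\<close>, which majorises \<open>\<bar>v0\<bar>\<close> and is bounded in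
  \<open>L\<^sup>m\<close> by Hardy's inequality, and of Borel versions of \<open>\<bar>s * v0' s\<bar>\<close> and \<open>\<bar>s * v1 s\<bar>\<close>.
\<close>

lemma wave_F_density:
  assumes m: "1 < m" and amb: "(v0, v1) \<in> Lm_ambient m"
    and l: "Lm_norm m v0 v1 = ennreal l" "0 \<le> l"
  obtains f where "f \<in> borel_measurable borel" "\<And>s. 0 \<le> f s"
    "(\<integral>\<^sup>+s. ennreal (f s powr m) \<partial>lborel) \<le> ennreal (density_const m * l powr m)"
    "\<And>a b. a \<le> b \<Longrightarrow> ennreal \<bar>wave_F v0 v1 b - wave_F v0 v1 a\<bar>
        \<le> (\<integral>\<^sup>+s\<in>{a<..<b}. ennreal (f s) \<partial>lborel)"
proof -
  have lac: "loc_abs_cont v0" and lim: "(v0 \<longlongrightarrow> 0) at_top"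
    and v1: "v1 \<in> borel_measurable (lebesgue_on {0<..})"
    using amb by (auto simp: Lm_ambient_def)
  obtain g where g [measurable]: "g \<in> borel_measurable borel" and g0: "\<And>x. 0 \<le> g x"
    and g_ae: "AE x in lborel. 0 < x \<longrightarrow> g x = \<bar>deriv v0 x\<bar>"
    by (rule borel_version_abs[OF loc_abs_cont_deriv_measurable[OF lac]]) (rule that)
  have v1_leb: "(\<lambda>x. indicator {0<..} x * v1 x) \<in> borel_measurable lebesgue"
    using v1 by (simp add: borel_measurable_restrict_space_iff)
  obtain k where k [measurable]: "k \<in> borel_measurable borel" and k0: "\<And>x. 0 \<le> k x"
    and k_ae: "AE x in lborel. 0 < x \<longrightarrow> k x = \<bar>v1 x\<bar>"
    by (rule borel_version_abs[OF v1_leb]) (rule that)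
  define g1 where "g1 = (\<lambda>s. \<bar>s\<bar> * g s)"
  define k1 where "k1 = (\<lambda>s. \<bar>s\<bar> * k s)"
  have [measurable]: "g1 \<in> borel_measurable borel" "k1 \<in> borel_measurable borel"
    unfolding g1_def k1_def by measurable
  have g1: "0 \<le> g1 x" and k1: "0 \<le> k1 x" for x by (auto simp: g1_def k1_def g0 k0)
  have data: "(\<integral>\<^sup>+r\<in>{0<..}. ennreal (g1 r powr m) \<partial>lborel) + (\<integral>\<^sup>+r\<in>{0<..}. ennreal (k1 r powr m) \<partial>lborel)
      = ennreal (l powr m)"
  proof -
    have "(\<integral>\<^sup>+r\<in>{0<..}. ennreal (g1 r powr m) \<partial>lborel) + (\<integral>\<^sup>+r\<in>{0<..}. ennreal (k1 r powr m) \<partial>lborel)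
        = (\<integral>\<^sup>+r. ennreal (g1 r powr m) * indicator {0<..} r + ennreal (k1 r powr m) * indicator {0<..} r \<partial>lborel)"
      by (rule nn_integral_add[symmetric]) auto
    also have "\<dots> = (\<integral>\<^sup>+ r \<in> {0<..}. ennreal (\<bar>r * deriv v0 r\<bar> powr m + \<bar>r * v1 r\<bar> powr m) \<partial>lborel)"
    proof (rule nn_integral_cong_AE)
      show "AE r in lborel. ennreal (g1 r powr m) * indicator {0<..} r + ennreal (k1 r powr m) * indicator {0<..} r
        = ennreal (\<bar>r * deriv v0 r\<bar> powr m + \<bar>r * v1 r\<bar> powr m) * indicator {0<..} r"
        using g_ae k_ae by eventually_elim (auto simp: indicator_def g1_def k1_def abs_mult)
    qed
    also have "\<dots> = ennreal (l powr m)" by (rule Lm_norm_integral[OF m l])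
    finally show ?thesis .
  qed
  have g1_le: "(\<integral>\<^sup>+r\<in>{0<..}. ennreal (g1 r powr m) \<partial>lborel) \<le> ennreal (l powr m)"
    unfolding data[symmetric] by simp
  define tail where "tail = (\<lambda>r. \<integral>\<^sup>+s\<in>{r<..}. ennreal (g s) \<partial>lborel)"
  have tail_eq: "tail r = (\<integral>\<^sup>+s\<in>{r<..}. ennreal (g1 s / s) \<partial>lborel)" if "0 < r" for r
    unfolding tail_def using that by (intro nn_integral_cong) (auto simp: indicator_def g1_def)
  have [measurable]: "tail \<in> borel_measurable borel"
    unfolding tail_def indicator_def greaterThan_iff by measurable
  have tail_fin: "tail r \<noteq> \<infinity>" if r: "0 < r" for r
  proof -
    have "epowr (tail r) m \<le> ennreal (m powr (m - 1) * r powr (1 / m - 1))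
           * (\<integral>\<^sup>+s\<in>{r<..}. ennreal (s powr (- 1 / m) * g1 s powr m) \<partial>lborel)"
      unfolding tail_eq[OF r] by (rule hardy_tail) (use m g1 r in auto)
    also have "(\<integral>\<^sup>+s\<in>{r<..}. ennreal (s powr (- 1 / m) * g1 s powr m) \<partial>lborel)
        \<le> (\<integral>\<^sup>+s. ennreal (r powr (- 1 / m)) * (ennreal (g1 s powr m) * indicator {0<..} s) \<partial>lborel)"
      using m r by (intro nn_integral_mono)
        (auto simp: indicator_def ennreal_mult[symmetric] intro!: ennreal_leI mult_right_mono powr_mono2')
    also have "\<dots> = ennreal (r powr (- 1 / m)) * (\<integral>\<^sup>+s\<in>{0<..}. ennreal (g1 s powr m) \<partial>lborel)"
      by (rule nn_integral_cmult) simp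
    also have "\<dots> \<le> ennreal (r powr (- 1 / m)) * ennreal (l powr m)"
      by (intro mult_left_mono g1_le) simp
    finally have "epowr (tail r) m \<le> ennreal (m powr (m - 1) * r powr (1 / m - 1))
        * (ennreal (r powr (- 1 / m)) * ennreal (l powr m))"
      by (simp add: mult_left_mono)
    also have "\<dots> < \<infinity>" by (simp add: ennreal_mult_less_top)
    finally show ?thesis by (auto simp: epowr_def)
  qed
  define G where "G = (\<lambda>r. enn2real (tail r))"
  have [measurable]: "G \<in> borel_measurable borel" unfolding G_def by measurable
  have G0: "0 \<le> G x" for x by (simp add: G_def)
  have G_eq: "ennreal (G r) = tail r" if "0 < r" for r
    using tail_fin[OF that] by (simp add: G_def less_top)
  have anti: "G y \<le> G x" if "0 < x" "x \<le> y" for x y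
  proof -
    have "tail y \<le> tail x"
      unfolding tail_def using that by (intro nn_integral_mono) (auto simp: indicator_def)
    then show ?thesis using tail_fin[OF that(1)] by (simp add: G_def enn2real_mono less_top)
  qed
  have inc: "ennreal \<bar>v0 y - v0 x\<bar> \<le> (\<integral>\<^sup>+s\<in>{x<..<y}. ennreal (g s) \<partial>lborel)" if "0 < x" "x \<le> y" for x y
    by (rule loc_abs_cont_increment[OF lac g g_ae that])
  have v0_le: "\<bar>v0 x\<bar> \<le> G x" if x: "0 < x" for x
  proof -
    have "ennreal \<bar>v0 x\<bar> \<le> tail x"
      unfolding tail_def by (rule abs_le_tail_variation[OF inc[OF x] lim])
    then show ?thesis using G_eq[OF x] G0[of x] by (metis ennreal_le_iff)
  qed
  have G_le: "(\<integral>\<^sup>+r\<in>{0<..}. ennreal (G r powr m) \<partial>lborel) \<le> ennreal (m powr m * l powr m)"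
  proof -
    have "(\<integral>\<^sup>+r\<in>{0<..}. ennreal (G r powr m) \<partial>lborel)
        = (\<integral>\<^sup>+r\<in>{0<..}. epowr (\<integral>\<^sup>+s\<in>{r<..}. ennreal (g1 s / s) \<partial>lborel) m \<partial>lborel)"
    proof (intro nn_integral_cong)
      fix r :: real
      have "ennreal (G r powr m) = epowr (\<integral>\<^sup>+s\<in>{r<..}. ennreal (g1 s / s) \<partial>lborel) m" if "0 < r"
        unfolding tail_eq[OF that, symmetric] G_eq[OF that, symmetric] by (simp add: epowr_ennreal G0)
      then show "ennreal (G r powr m) * indicator {0<..} r
          = epowr (\<integral>\<^sup>+s\<in>{r<..}. ennreal (g1 s / s) \<partial>lborel) m * indicator {0<..} r"
        by (cases "0 < r") auto
    qed
    also have "\<dots> \<le> ennreal (m powr m) * (\<integral>\<^sup>+s\<in>{0<..}. ennreal (g1 s powr m) \<partial>lborel)"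
      by (rule hardy_inequality) (use m g1 in auto)
    also have "\<dots> \<le> ennreal (m powr m) * ennreal (l powr m)"
      by (intro mult_left_mono g1_le) simp
    finally show ?thesis by (simp add: ennreal_mult)
  qed
  define h where "h = (\<lambda>x. (G x + g1 x + k1 x) / 2)"
  have h_meas [measurable]: "h \<in> borel_measurable borel" unfolding h_def by measurable
  have h0: "0 \<le> h x" for x by (simp add: h_def G0 g1 k1)
  define f where "f = (\<lambda>s. h \<bar>s\<bar>)"
  have f_meas [measurable]: "f \<in> borel_measurable borel" unfolding f_def by measurable
  have f0: "0 \<le> f x" for x by (simp add: f_def h0)
  have f_le: "(\<integral>\<^sup>+s. ennreal (f s powr m) \<partial>lborel) \<le> ennreal (density_const m * l powr m)"
  proof -
    have "(\<integral>\<^sup>+s\<in>{0<..}. ennreal (h s powr m) \<partial>lborel)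
      \<le> (\<integral>\<^sup>+s. ennreal (3 powr m) * (ennreal (G s powr m) * indicator {0<..} s
          + (ennreal (g1 s powr m) * indicator {0<..} s + ennreal (k1 s powr m) * indicator {0<..} s)) \<partial>lborel)"
    proof (rule nn_integral_mono)
      fix s
      have "h s powr m \<le> (G s + g1 s + k1 s) powr m"
        using m G0 g1 k1 by (intro powr_mono2) (auto simp: h_def)
      also have "\<dots> \<le> 3 powr m * (G s powr m + g1 s powr m + k1 s powr m)"
        using m G0 g1 k1 by (intro powr_add3_le) auto
      finally have "ennreal (h s powr m) \<le> ennreal (3 powr m) *
          (ennreal (G s powr m) + (ennreal (g1 s powr m) + ennreal (k1 s powr m)))"
        by (simp add: ennreal_mult[symmetric] ennreal_plus[symmetric] ennreal_leI add.assoc del: ennreal_plus)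
      then show "ennreal (h s powr m) * indicator {0<..} s \<le> ennreal (3 powr m) * (ennreal (G s powr m) * indicator {0<..} s
          + (ennreal (g1 s powr m) * indicator {0<..} s + ennreal (k1 s powr m) * indicator {0<..} s))"
        by (simp add: indicator_def)
    qed
    also have "\<dots> = ennreal (3 powr m) * (\<integral>\<^sup>+s. ennreal (G s powr m) * indicator {0<..} s
          + (ennreal (g1 s powr m) * indicator {0<..} s + ennreal (k1 s powr m) * indicator {0<..} s) \<partial>lborel)"
      by (rule nn_integral_cmult) measurable
    also have "(\<integral>\<^sup>+s. ennreal (G s powr m) * indicator {0<..} s
          + (ennreal (g1 s powr m) * indicator {0<..} s + ennreal (k1 s powr m) * indicator {0<..} s) \<partial>lborel)
      = (\<integral>\<^sup>+r\<in>{0<..}. ennreal (G r powr m) \<partial>lborel)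
        + (\<integral>\<^sup>+s. ennreal (g1 s powr m) * indicator {0<..} s + ennreal (k1 s powr m) * indicator {0<..} s \<partial>lborel)"
      by (rule nn_integral_add) measurable
    also have "(\<integral>\<^sup>+s. ennreal (g1 s powr m) * indicator {0<..} s + ennreal (k1 s powr m) * indicator {0<..} s \<partial>lborel)
        = ennreal (l powr m)"
      unfolding data[symmetric] by (rule nn_integral_add) measurable
    also have "ennreal (3 powr m) * ((\<integral>\<^sup>+r\<in>{0<..}. ennreal (G r powr m) \<partial>lborel) + ennreal (l powr m))
        \<le> ennreal (3 powr m) * (ennreal (m powr m * l powr m) + ennreal (l powr m))"
      by (intro mult_left_mono add_right_mono G_le) simp
    finally have half_line: "(\<integral>\<^sup>+s\<in>{0<..}. ennreal (h s powr m) \<partial>lborel)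
        \<le> ennreal (3 powr m) * (ennreal (m powr m * l powr m) + ennreal (l powr m))" .
    have "(\<integral>\<^sup>+s. ennreal (f s powr m) \<partial>lborel) = ennreal 2 * (\<integral>\<^sup>+s\<in>{0<..}. ennreal (h s powr m) \<partial>lborel)"
      unfolding f_def ennreal_numeral by (rule nn_integral_even) simp
    also have "\<dots> \<le> ennreal 2 * (ennreal (3 powr m) * (ennreal (m powr m * l powr m) + ennreal (l powr m)))"
      by (intro mult_left_mono half_line) simp
    also have "\<dots> = ennreal (density_const m * l powr m)"
      unfolding density_const_def
      by (simp add: ennreal_mult[symmetric] ennreal_plus[symmetric] algebra_simps del: ennreal_plus ennreal_numeral)
    finally show ?thesis .
  qed
  define W where "W = (\<lambda>x. LINT \<rho>:{0..x}|lebesgue. \<rho> * v1 \<rho>)"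
  \<comment> \<open>Without integrability the Lebesgue integral in \<open>wave_F\<close> would have the default value \<open>0\<close>.\<close>
  have W_int: "set_integrable lebesgue {0..x} (\<lambda>\<rho>. \<rho> * v1 \<rho>)" if x: "0 \<le> x" for x
    unfolding set_integrable_def
  proof (rule integrableI_bounded)
    have "(\<lambda>\<rho>. indicator {0..x} \<rho> *\<^sub>R (\<rho> * v1 \<rho>)) = (\<lambda>\<rho>. indicator {0..x} \<rho> * \<rho> * (indicator {0<..} \<rho> * v1 \<rho>))"
      by (auto simp: indicator_def fun_eq_iff)
    also have "\<dots> \<in> borel_measurable lebesgue"
      by (intro borel_measurable_times v1_leb) (auto simp: measurable_completion)
    finally show "(\<lambda>\<rho>. indicator {0..x} \<rho> *\<^sub>R (\<rho> * v1 \<rho>)) \<in> borel_measurable lebesgue" .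
    have "(\<integral>\<^sup>+ \<rho>. ennreal (norm (indicator {0..x} \<rho> *\<^sub>R (\<rho> * v1 \<rho>))) \<partial>lebesgue)
        = (\<integral>\<^sup>+ \<rho>. ennreal (norm (indicator {0..x} \<rho> *\<^sub>R (\<rho> * v1 \<rho>))) \<partial>lborel)"
      by (rule nn_integral_completion)
    also have "\<dots> \<le> (\<integral>\<^sup>+s. 2 * (ennreal (f s) * indicator {0 - (x + 1)<..<0 + (x + 1)} s) \<partial>lborel)"
    proof (rule nn_integral_mono_AE)
      show "AE s in lborel. ennreal (norm (indicator {0..x} s *\<^sub>R (s * v1 s)))
          \<le> 2 * (ennreal (f s) * indicator {0 - (x + 1)<..<0 + (x + 1)} s)"
        using k_ae
      proof eventually_elim
        case (elim s)
        have "\<bar>s * v1 s\<bar> \<le> 2 * f s" if "0 \<le> s"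
        proof (cases "s = 0")
          case False
          with that elim have "\<bar>s * v1 s\<bar> = k1 s" by (simp add: k1_def abs_mult)
          then show ?thesis using that G0[of s] g1[of s] by (simp add: f_def h_def)
        qed (simp add: f0)
        then have "ennreal \<bar>s * v1 s\<bar> \<le> 2 * ennreal (f s)" if "0 \<le> s"
          using that f0[of s] by (metis ennreal_leI ennreal_mult ennreal_numeral zero_le_numeral)
        then show ?case by (auto simp: indicator_def)
      qed
    qed
    also have "\<dots> = 2 * window_mass f 0 (x + 1)"
      unfolding window_mass_def by (rule nn_integral_cmult) simp
    also have "\<dots> < \<infinity>"
    proof -
      have "window_mass f 0 (x + 1)
          \<le> ennreal ((2 * (x + 1)) powr (1 - 1 / m) * ((density_const m * l powr m) powr (1 / m)))"
        by (rule window_mass_le) (use m f0 f_le x in \<open>auto simp: powr_powr density_const_def\<close>)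
      then show ?thesis by (auto simp: ennreal_mult_less_top intro: le_less_trans)
    qed
    finally show "(\<integral>\<^sup>+ \<rho>. ennreal (norm (indicator {0..x} \<rho> *\<^sub>R (\<rho> * v1 \<rho>))) \<partial>lebesgue) < \<infinity>" .
  qed
  have half: "ennreal (\<bar>b * v0 b - a * v0 a\<bar> / 2 + \<bar>W b - W a\<bar> / 2) \<le> (\<integral>\<^sup>+s\<in>{a<..<b}. ennreal (f s) \<partial>lborel)"
    if ab: "0 \<le> a" "a \<le> b" for a b
  proof -
    have "ennreal (\<bar>b * v0 b - a * v0 a\<bar> + \<bar>W b - W a\<bar>) = ennreal \<bar>b * v0 b - a * v0 a\<bar> + ennreal \<bar>W b - W a\<bar>"
      by (rule ennreal_plus) auto
    also have "ennreal \<bar>b * v0 b - a * v0 a\<bar>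
        \<le> (\<integral>\<^sup>+s\<in>{a<..<b}. ennreal (G s) \<partial>lborel) + (\<integral>\<^sup>+s\<in>{a<..<b}. ennreal (g1 s) \<partial>lborel)"
      unfolding g1_def by (rule radius_times_increment) (use g0 G0 inc v0_le anti ab in auto)
    also have "ennreal \<bar>W b - W a\<bar> \<le> (\<integral>\<^sup>+s\<in>{a<..<b}. ennreal (k1 s) \<partial>lborel)"
      unfolding W_def
    proof (rule set_integral_increment[OF W_int _ ab])
      show "AE s in lborel. 0 < s \<longrightarrow> k1 s = \<bar>s * v1 s\<bar>"
        using k_ae by eventually_elim (auto simp: k1_def abs_mult)
    qed
    finally have "ennreal (\<bar>b * v0 b - a * v0 a\<bar> + \<bar>W b - W a\<bar>)
        \<le> (\<integral>\<^sup>+s\<in>{a<..<b}. ennreal (G s) \<partial>lborel) + (\<integral>\<^sup>+s\<in>{a<..<b}. ennreal (g1 s) \<partial>lborel)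
          + (\<integral>\<^sup>+s\<in>{a<..<b}. ennreal (k1 s) \<partial>lborel)"
      by (simp add: add_mono)
    also have "\<dots> = (\<integral>\<^sup>+s. (ennreal (G s) * indicator {a<..<b} s + ennreal (g1 s) * indicator {a<..<b} s)
          + ennreal (k1 s) * indicator {a<..<b} s \<partial>lborel)"
      by (simp add: nn_integral_add)
    also have "\<dots> = (\<integral>\<^sup>+s. ennreal 2 * (ennreal (f s) * indicator {a<..<b} s) \<partial>lborel)"
      using ab G0 g1 k1 h0
      by (intro nn_integral_cong)
         (auto simp: indicator_def f_def ennreal_mult[symmetric] ennreal_plus[symmetric] h_def
            simp del: ennreal_plus ennreal_numeral)
    also have "\<dots> = ennreal 2 * (\<integral>\<^sup>+s\<in>{a<..<b}. ennreal (f s) \<partial>lborel)"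
      by (rule nn_integral_cmult) simp
    finally have "ennreal (1 / 2) * ennreal (\<bar>b * v0 b - a * v0 a\<bar> + \<bar>W b - W a\<bar>)
        \<le> ennreal (1 / 2) * (ennreal 2 * (\<integral>\<^sup>+s\<in>{a<..<b}. ennreal (f s) \<partial>lborel))"
      by (rule mult_left_mono) simp
    also have "\<dots> = (\<integral>\<^sup>+s\<in>{a<..<b}. ennreal (f s) \<partial>lborel)"
    proof -
      have "ennreal (1 / 2) * ennreal 2 = ennreal (1 / 2 * 2)"
        by (rule ennreal_mult[symmetric]) auto
      then have "ennreal (1 / 2) * ennreal 2 = 1" by simp
      then show ?thesis by (simp only: mult.assoc[symmetric] mult_1)
    qed
    finally have "ennreal (1 / 2) * ennreal (\<bar>b * v0 b - a * v0 a\<bar> + \<bar>W b - W a\<bar>)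
        \<le> (\<integral>\<^sup>+s\<in>{a<..<b}. ennreal (f s) \<partial>lborel)" .
    moreover have "ennreal (1 / 2) * ennreal (\<bar>b * v0 b - a * v0 a\<bar> + \<bar>W b - W a\<bar>)
        = ennreal (\<bar>b * v0 b - a * v0 a\<bar> / 2 + \<bar>W b - W a\<bar> / 2)"
      by (subst ennreal_mult[symmetric]) (auto simp: add_divide_distrib)
    ultimately show ?thesis by simp
  qed
  let ?F = "wave_F v0 v1"
  have F: "?F \<sigma> = \<sigma> * v0 \<bar>\<sigma>\<bar> / 2 + W \<bar>\<sigma>\<bar> / 2" for \<sigma> by (simp add: wave_F_def W_def)
  have triangle: "\<bar>(x + y) / 2\<bar> \<le> \<bar>x\<bar> / 2 + \<bar>y\<bar> / 2" "\<bar>(x - y) / 2\<bar> \<le> \<bar>x\<bar> / 2 + \<bar>y\<bar> / 2" for x y :: real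
    using abs_triangle_ineq[of x y] abs_triangle_ineq4[of x y] by simp_all
  have pos: "ennreal \<bar>?F b - ?F a\<bar> \<le> (\<integral>\<^sup>+s\<in>{a<..<b}. ennreal (f s) \<partial>lborel)" if ab: "0 \<le> a" "a \<le> b" for a b
  proof -
    have "?F a = a * v0 a / 2 + W a / 2" "?F b = b * v0 b / 2 + W b / 2"
      using ab by (simp_all add: F)
    then have "?F b - ?F a = ((b * v0 b - a * v0 a) + (W b - W a)) / 2"
      by (simp add: field_simps)
    then have "\<bar>?F b - ?F a\<bar> \<le> \<bar>b * v0 b - a * v0 a\<bar> / 2 + \<bar>W b - W a\<bar> / 2"
      by (simp only: triangle)
    then show ?thesis using half[OF ab] by (meson ennreal_leI order_trans)
  qed
  have neg: "ennreal \<bar>?F b - ?F a\<bar> \<le> (\<integral>\<^sup>+s\<in>{a<..<b}. ennreal (f s) \<partial>lborel)" if ab: "a \<le> b" "b \<le> 0" for a b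
  proof -
    have "?F a = - ((- a) * v0 (- a)) / 2 + W (- a) / 2" "?F b = - ((- b) * v0 (- b)) / 2 + W (- b) / 2"
      using ab by (simp_all add: F)
    then have "?F b - ?F a = (((- a) * v0 (- a) - (- b) * v0 (- b)) - (W (- a) - W (- b))) / 2"
      by (simp add: field_simps)
    then have "\<bar>?F b - ?F a\<bar> \<le> \<bar>(- a) * v0 (- a) - (- b) * v0 (- b)\<bar> / 2 + \<bar>W (- a) - W (- b)\<bar> / 2"
      by (simp only: triangle)
    then have "ennreal \<bar>?F b - ?F a\<bar>
        \<le> ennreal (\<bar>(- a) * v0 (- a) - (- b) * v0 (- b)\<bar> / 2 + \<bar>W (- a) - W (- b)\<bar> / 2)"
      by (rule ennreal_leI)
    also have "\<dots> \<le> (\<integral>\<^sup>+s\<in>{- b<..<- a}. ennreal (f s) \<partial>lborel)"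
      by (rule half) (use ab in auto)
    also have "\<dots> = (\<integral>\<^sup>+s\<in>{a<..<b}. ennreal (f s) \<partial>lborel)"
      unfolding f_def by (rule nn_integral_even_interval) simp
    finally show ?thesis .
  qed
  have "ennreal \<bar>?F b - ?F a\<bar> \<le> (\<integral>\<^sup>+s\<in>{a<..<b}. ennreal (f s) \<partial>lborel)" if ab: "a \<le> b" for a b
  proof -
    consider "0 \<le> a" | "b \<le> 0" | "a \<le> 0" "0 \<le> b" by linarith
    then show ?thesis
    proof cases
      case 3
      have "ennreal \<bar>?F b - ?F a\<bar> \<le> ennreal (\<bar>?F b - ?F 0\<bar> + \<bar>?F 0 - ?F a\<bar>)"
        by (rule ennreal_leI) linarith
      also have "\<dots> \<le> (\<integral>\<^sup>+s\<in>{0<..<b}. ennreal (f s) \<partial>lborel) + (\<integral>\<^sup>+s\<in>{a<..<0}. ennreal (f s) \<partial>lborel)"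
        using pos[of 0 b] neg[of a 0] 3 by (simp add: ennreal_plus add_mono)
      also have "\<dots> = (\<integral>\<^sup>+s. ennreal (f s) * indicator {0<..<b} s + ennreal (f s) * indicator {a<..<0} s \<partial>lborel)"
        by (rule nn_integral_add[symmetric]) auto
      also have "\<dots> \<le> (\<integral>\<^sup>+s\<in>{a<..<b}. ennreal (f s) \<partial>lborel)"
        using 3 by (intro nn_integral_mono) (auto simp: indicator_def)
      finally show ?thesis .
    qed (use pos neg ab in auto)
  qed
  then show thesis by (rule that[OF f_meas f0 f_le])
qed

lemma window_mass_interval:
  "(\<integral>\<^sup>+s\<in>{a<..<b}. ennreal (f s) \<partial>lborel) = window_mass f ((a + b) / 2) ((b - a) / 2)"
  by (simp add: window_mass_def field_simps)

section \<open>The Strichartz estimate\<close>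

text \<open>
  Hoelder's inequality on the interval makes \<open>F\<close> Hoelder continuous with exponent \<open>1 - 1/m\<close>.
\<close>

lemma continuous_on_if_interval_density:
  fixes F f :: "real \<Rightarrow> real"
  assumes m: "1 < m" and f_meas: "f \<in> borel_measurable borel" and f: "\<And>s. 0 \<le> f s"
    and N: "0 \<le> N" "(\<integral>\<^sup>+s. ennreal (f s powr m) \<partial>lborel) \<le> ennreal (N powr m)"
    and F: "\<And>a b. a \<le> b \<Longrightarrow> ennreal \<bar>F b - F a\<bar> \<le> (\<integral>\<^sup>+s\<in>{a<..<b}. ennreal (f s) \<partial>lborel)"
  shows "continuous_on UNIV F"
proof -
  have less: "\<bar>F b - F a\<bar> \<le> (b - a) powr (1 - 1 / m) * N" if "a < b" for a b
  proof -
    have "ennreal \<bar>F b - F a\<bar> \<le> window_mass f ((a + b) / 2) ((b - a) / 2)"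
      using F[of a b] that by (simp add: window_mass_interval)
    also have "\<dots> \<le> ennreal ((2 * ((b - a) / 2)) powr (1 - 1 / m) * N)"
      by (rule window_mass_le) (use m f_meas f N that in auto)
    also have "2 * ((b - a) / 2) = b - a" by simp
    finally show ?thesis using N by simp
  qed
  have holder: "\<bar>F b - F a\<bar> \<le> \<bar>b - a\<bar> powr (1 - 1 / m) * N" for a b
    using less[of a b] less[of b a] by (cases a b rule: linorder_cases) (auto simp: abs_minus_commute)
  have "(F \<longlongrightarrow> F a) (at a)" for a
  proof (rule Lim_transform2[OF tendsto_const])
    have "((\<lambda>b. \<bar>b - a\<bar> powr (1 - 1 / m) * N) \<longlongrightarrow> \<bar>a - a\<bar> powr (1 - 1 / m) * N) (at a)"
      by (intro tendsto_intros) (use m in auto)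
    then have lim: "((\<lambda>b. \<bar>b - a\<bar> powr (1 - 1 / m) * N) \<longlongrightarrow> 0) (at a)" by simp
    show "((\<lambda>b. F a - F b) \<longlongrightarrow> 0) (at a)"
      by (rule Lim_null_comparison[OF _ lim]) (use holder in \<open>auto simp: abs_minus_commute\<close>)
  qed
  then show ?thesis by (simp add: continuous_on_def)
qed

lemma linear_wave_measurable:
  assumes "continuous_on UNIV (wave_F v0 v1)"
  shows "(\<lambda>(t, r). linear_wave v0 v1 t r) \<in> borel_measurable (lebesgue_on (UNIV \<times> {0<..}))"
proof (rule continuous_imp_measurable_on_sets_lebesgue)
  have comp: "continuous_on S (\<lambda>x. wave_F v0 v1 (h x))" if "continuous_on S h" for S and h :: "real \<times> real \<Rightarrow> real"
    using continuous_on_compose2[OF assms that] by simp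
  show "continuous_on (UNIV \<times> {0<..}) (\<lambda>(t, r). linear_wave v0 v1 t r)"
    unfolding linear_wave_def case_prod_unfold by (intro continuous_intros comp) auto
  have "open (UNIV \<times> {0<..} :: (real \<times> real) set)" by (intro open_Times) auto
  then show "(UNIV \<times> {0<..} :: (real \<times> real) set) \<in> sets lebesgue"
    by (intro sets_completionI_sets) simp
qed

text \<open>
  The constant of the estimate for increasing functions, with the exponent \<open>a = 2 * m - 1/m\<close>, times that of
  the space-time estimate; the outer root is the one in \<open>S_norm\<close>.
\<close>

definition strichartz_const :: "real \<Rightarrow> real" where
  "strichartz_const m = ((2 * m - 1 / m) powr (1 - 1 / m) *
     (4 powr (2 * m + 1) * (1 + m / (m - 1)))) powr (1 / (2 * m + 1))"

text \<open>
  For fixed \<open>t\<close> the window mass increases with \<open>r\<close>, so that the inner integral of \<open>S_norm\<close>, of exponent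
  \<open>1/m\<close>, is linearised, and the space-time estimate applies.
\<close>

lemma S_norm_le_if_window_bound:
  fixes v :: "real \<Rightarrow> real \<Rightarrow> real"
  assumes m: "1 < m" and f_meas [measurable]: "f \<in> borel_measurable borel" and f: "\<And>s. 0 \<le> f s"
    and N: "0 < N" "(\<integral>\<^sup>+s. ennreal (f s powr m) \<partial>lborel) \<le> ennreal (N powr m)"
    and v: "\<And>t r. 0 < r \<Longrightarrow> \<bar>v t r\<bar> \<le> enn2real (window_mass f t r) / r"
  shows "S_norm m UNIV v \<le> ennreal (strichartz_const m * N)"
proof -
  define a where "a = 2 * m - 1 / m"
  have a: "0 < a"
  proof -
    have "1 / m < 1" using m by simp
    then show ?thesis unfolding a_def using m by linarith
  qed
  let ?H = "\<lambda>t r. enn2real (window_mass f t r)"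
  let ?J = "\<lambda>t. \<integral>\<^sup>+r\<in>{0<..}. ennreal (?H t r powr (2 * m + 1) * r powr (- a - 1)) \<partial>lborel"
  have H_mono: "?H t r \<le> ?H t s" if "0 < r" "r \<le> s" for t r s
  proof (rule enn2real_mono)
    show "window_mass f t r \<le> window_mass f t s"
      unfolding window_mass_def using that by (intro nn_integral_mono) (auto simp: indicator_def)
    have "window_mass f t s \<le> ennreal ((2 * s) powr (1 - 1 / m) * N)"
      by (rule window_mass_le) (use m f N that in auto)
    then show "window_mass f t s < top" by (rule le_less_trans) simp
  qed
  have inner: "epowr (\<integral>\<^sup>+r\<in>{0<..}. ennreal (\<bar>v t r\<bar> powr ((2 * m + 1) * m) * r powr m) \<partial>lebesgue) (1 / m)
      \<le> ennreal (a powr (1 - 1 / m)) * ?J t" for t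
  proof -
    have "(\<integral>\<^sup>+r\<in>{0<..}. ennreal (\<bar>v t r\<bar> powr ((2 * m + 1) * m) * r powr m) \<partial>lebesgue)
        = (\<integral>\<^sup>+r\<in>{0<..}. ennreal (\<bar>v t r\<bar> powr ((2 * m + 1) * m) * r powr m) \<partial>lborel)"
      by (rule nn_integral_completion)
    also have "\<dots> \<le> (\<integral>\<^sup>+r\<in>{0<..}. ennreal ((?H t r powr (2 * m + 1)) powr m * r powr (- a * m - 1)) \<partial>lborel)"
    proof (rule nn_integral_mono)
      fix r :: real
      have "\<bar>v t r\<bar> powr ((2 * m + 1) * m) * r powr m
          \<le> (?H t r powr (2 * m + 1)) powr m * r powr (- a * m - 1)" if r: "0 < r"
      proof -
        have "\<bar>v t r\<bar> powr ((2 * m + 1) * m) * r powr m \<le> (?H t r / r) powr ((2 * m + 1) * m) * r powr m"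
          using m v[OF r] by (intro mult_right_mono powr_mono2) auto
        also have "(?H t r / r) powr ((2 * m + 1) * m) = ?H t r powr ((2 * m + 1) * m) * r powr (- ((2 * m + 1) * m))"
          using r by (simp add: powr_divide powr_minus_divide)
        also have "?H t r powr ((2 * m + 1) * m) * r powr (- ((2 * m + 1) * m)) * r powr m
            = ?H t r powr ((2 * m + 1) * m) * r powr (- ((2 * m + 1) * m) + m)"
          by (simp only: mult.assoc powr_add)
        \<comment> \<open>this identity determines \<open>a\<close>\<close>
        also have "- ((2 * m + 1) * m) + m = - a * m - 1"
          using m by (simp add: a_def field_simps)
        finally show ?thesis by (simp only: powr_powr)
      qed
      then show "ennreal (\<bar>v t r\<bar> powr ((2 * m + 1) * m) * r powr m) * indicator {0<..} r
          \<le> ennreal ((?H t r powr (2 * m + 1)) powr m * r powr (- a * m - 1)) * indicator {0<..} r"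
        by (cases "0 < r") (simp_all add: ennreal_leI)
    qed
    finally have "epowr (\<integral>\<^sup>+r\<in>{0<..}. ennreal (\<bar>v t r\<bar> powr ((2 * m + 1) * m) * r powr m) \<partial>lebesgue) (1 / m)
        \<le> epowr (\<integral>\<^sup>+r\<in>{0<..}. ennreal ((?H t r powr (2 * m + 1)) powr m * r powr (- a * m - 1)) \<partial>lborel) (1 / m)"
      using m by (intro epowr_mono) auto
    also have "\<dots> \<le> ennreal (a powr (1 - 1 / m)) * ?J t"
    proof (rule nn_integral_powr_increasing)
      show "?H t r powr (2 * m + 1) \<le> ?H t s powr (2 * m + 1)" if "0 < r" "r \<le> s" for r s
        using m H_mono[OF that] by (intro powr_mono2) auto
    qed (use a m in auto)
    finally show ?thesis .
  qed
  have "(\<integral>\<^sup>+t\<in>UNIV. epowr (\<integral>\<^sup>+r\<in>{0<..}. ennreal (\<bar>v t r\<bar> powr ((2 * m + 1) * m) * r powr m) \<partial>lebesgue) (1 / m) \<partial>lebesgue)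
      = (\<integral>\<^sup>+t\<in>UNIV. epowr (\<integral>\<^sup>+r\<in>{0<..}. ennreal (\<bar>v t r\<bar> powr ((2 * m + 1) * m) * r powr m) \<partial>lebesgue) (1 / m) \<partial>lborel)"
    by (rule nn_integral_completion)
  also have "\<dots> \<le> (\<integral>\<^sup>+t. ennreal (a powr (1 - 1 / m)) * ?J t \<partial>lborel)"
    using inner by (intro nn_integral_mono) simp
  also have "\<dots> = ennreal (a powr (1 - 1 / m)) * (\<integral>\<^sup>+t. ?J t \<partial>lborel)"
    by (rule nn_integral_cmult) measurable
  also have "\<dots> \<le> ennreal (a powr (1 - 1 / m)) * ennreal (4 powr (2 * m + 1) * (1 + m / (m - 1)) * N powr (2 * m + 1))"
  proof (rule mult_left_mono)
    have "- a - 1 = 1 / m - 2 * m - 1" by (simp add: a_def)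
    then show "(\<integral>\<^sup>+t. ?J t \<partial>lborel) \<le> ennreal (4 powr (2 * m + 1) * (1 + m / (m - 1)) * N powr (2 * m + 1))"
      using nn_integral_window_mass_power[OF m f_meas f N] by (simp only:)
  qed simp
  also have "\<dots> = ennreal ((strichartz_const m * N) powr (2 * m + 1))"
  proof -
    have "strichartz_const m powr (2 * m + 1) = a powr (1 - 1 / m) * (4 powr (2 * m + 1) * (1 + m / (m - 1)))"
      using m by (simp add: strichartz_const_def a_def powr_powr)
    then show ?thesis using m by (simp add: powr_mult ennreal_mult[symmetric] mult.assoc)
  qed
  finally have "S_norm m UNIV v \<le> epowr (ennreal ((strichartz_const m * N) powr (2 * m + 1))) (1 / (2 * m + 1))"
    unfolding S_norm_def using m by (intro epowr_mono) auto
  also have "\<dots> = ennreal (strichartz_const m * N)"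
    using m N by (subst epowr_ennreal) (auto simp: powr_powr strichartz_const_def)
  finally show ?thesis .
qed

lemma linear_wave_le_window_mass:
  assumes F: "\<And>a b. a \<le> b \<Longrightarrow> ennreal \<bar>wave_F v0 v1 b - wave_F v0 v1 a\<bar>
        \<le> (\<integral>\<^sup>+s\<in>{a<..<b}. ennreal (f s) \<partial>lborel)"
    and fin: "window_mass f t r \<noteq> \<infinity>" and r: "0 < r"
  shows "\<bar>linear_wave v0 v1 t r\<bar> \<le> enn2real (window_mass f t r) / r"
proof -
  have "ennreal \<bar>wave_F v0 v1 (t + r) - wave_F v0 v1 (t - r)\<bar> \<le> window_mass f t r"
    unfolding window_mass_def using F[of "t - r" "t + r"] r by simp
  then have "\<bar>wave_F v0 v1 (t + r) - wave_F v0 v1 (t - r)\<bar> \<le> enn2real (window_mass f t r)"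
    using fin enn2real_mono[of "ennreal \<bar>wave_F v0 v1 (t + r) - wave_F v0 v1 (t - r)\<bar>" "window_mass f t r"]
    by (simp add: less_top)
  then show ?thesis using r by (simp add: linear_wave_def divide_right_mono)
qed

theorem theorem1:
  fixes m :: real
  assumes "1 < m"
  shows "\<exists>C::real. C > 0 \<and>
    (\<forall>v0 v1. (v0, v1) \<in> Lm m \<longrightarrow>
       linear_wave v0 v1 \<in> S_space m UNIV \<and>
       S_norm m UNIV (linear_wave v0 v1) \<le> ennreal C * Lm_norm m v0 v1)"
proof (intro exI conjI allI impI)
  let ?D = "density_const m powr (1 / m)" and ?K = "strichartz_const m"
  have D0: "0 < density_const m" unfolding density_const_def by (simp add: add_nonneg_pos)
  have K: "0 < ?K"
  proof -
    have "1 / m < 1" "0 < m / (m - 1)" using assms by auto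
    then have "0 < 2 * m - 1 / m" "0 < 1 + m / (m - 1)" using assms by linarith+
    then show ?thesis by (simp add: strichartz_const_def)
  qed
  show "0 < ?K * ?D" using K D0 by simp
  fix v0 v1 assume "(v0, v1) \<in> Lm m"
  then have amb: "(v0, v1) \<in> Lm_ambient m" by (simp add: Lm_def)
  then have "Lm_norm m v0 v1 \<noteq> \<infinity>" by (auto simp: Lm_ambient_def)
  then obtain l where l: "Lm_norm m v0 v1 = ennreal l" "0 \<le> l" by (rule ennreal_finiteE)
  obtain f where f: "f \<in> borel_measurable borel" "\<And>s. 0 \<le> f s"
    and f_le: "(\<integral>\<^sup>+s. ennreal (f s powr m) \<partial>lborel) \<le> ennreal (density_const m * l powr m)"
    and F: "\<And>a b. a \<le> b \<Longrightarrow> ennreal \<bar>wave_F v0 v1 b - wave_F v0 v1 a\<bar>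
        \<le> (\<integral>\<^sup>+s\<in>{a<..<b}. ennreal (f s) \<partial>lborel)"
    by (rule wave_F_density[OF assms amb l]) (rule that)
  have f_norm: "(\<integral>\<^sup>+s. ennreal (f s powr m) \<partial>lborel) \<le> ennreal ((?D * l) powr m)"
    using f_le D0 assms by (simp add: powr_mult powr_powr)
  have N0: "0 \<le> ?D * l" using l by simp
  have fin: "window_mass f t r \<noteq> \<infinity>" if "0 < r" for t r
    using window_mass_le[OF assms f N0 f_norm that, of t] by (auto simp: top_unique)
  have S_le: "S_norm m UNIV (linear_wave v0 v1) \<le> ennreal (?K * N)" if N: "0 < N" "?D * l \<le> N" for N
  proof (rule S_norm_le_if_window_bound[OF assms f N(1)])
    have "(?D * l) powr m \<le> N powr m" using assms N N0 by (intro powr_mono2) auto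
    then show "(\<integral>\<^sup>+s. ennreal (f s powr m) \<partial>lborel) \<le> ennreal (N powr m)"
      using f_norm by (meson ennreal_leI order_trans)
  qed (rule linear_wave_le_window_mass[OF F fin])
  \<comment> \<open>The estimate is available for positive \<open>N\<close> only; letting \<open>N\<close> decrease to \<open>?D * l\<close> covers the case \<open>l = 0\<close>.\<close>
  have bound: "S_norm m UNIV (linear_wave v0 v1) \<le> ennreal (?K * (?D * l))"
  proof (rule ennreal_le_epsilon)
    fix e :: real assume e: "0 < e"
    have "S_norm m UNIV (linear_wave v0 v1) \<le> ennreal (?K * (?D * l + e / ?K))"
      using e K N0 by (intro S_le) (auto simp: add_nonneg_pos)
    also have "\<dots> = ennreal (?K * (?D * l)) + ennreal e"
      using e K N0 by (simp add: distrib_left ennreal_plus)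
    finally show "S_norm m UNIV (linear_wave v0 v1) \<le> ennreal (?K * (?D * l)) + ennreal e" .
  qed
  then show "S_norm m UNIV (linear_wave v0 v1) \<le> ennreal (?K * ?D) * Lm_norm m v0 v1"
    using l K by (simp add: ennreal_mult[symmetric] mult.assoc)
  have "continuous_on UNIV (wave_F v0 v1)"
    by (rule continuous_on_if_interval_density[OF assms f N0 f_norm F])
  then show "linear_wave v0 v1 \<in> S_space m UNIV"
    using linear_wave_measurable bound by (auto simp: S_space_def intro: le_less_trans)
qed

end
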